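(* Consider the A-RepC iteration (defined in the context) with parameters $\alpha$, $\eta$, $\lambda$ on an undirected connected graph $\mathcal G=(\mathcal V,\mathcal E)$ with $\mathcal V=\mathcal H\cup\mathcal B$ (honest and Byzantine nodes). Suppose that: (A1) $|\mathcal N_i\cap\mathcal H|>|\mathcal N_i\cap\mathcal B|$ for all $i\in\mathcal H$; (A2) the subgraph of $\mathcal G$ induced by $\mathcal H$ is connected; (A3) there is a constant $M_{\mathcal B}>0$ such that $\|x_{j\to i}^{(t)}\|\le M_{\mathcal B}$ for all $i\in\mathcal H$, $j\in\mathcal N_i\cap\mathcal B$, $t\ge 0$; and that $\lambda\in[0,1)$. Let $\rho_0, M, C_1, C_2$ and $E_{\mathcal H}^{(t)}$, $\|\cdot\|_{D_{\mathcal H}}$ be as defined in the context. For any fixed $\alpha\in(0,1)$, if $\eta>0$ satisfies $$\alpha\eta C_1<(1-\rho_0)(1-\lambda),$$ then there exist constants $\kappa\ge 1$ and $\rho\in(0,1)$ such that, for all $t\ge 0$, $$\left\|E_{\mathcal H}^{(t)}\right\|_{D_{\mathcal H}}\le \kappa\rho^t\left\|E_{\mathcal H}^{(0)}\right\|_{D_{\mathcal H}}+\frac{\alpha C_2 M}{(1-\rho_0)(1-\lambda)-\alpha\eta C_1}.$$ Consequently, the honest nodes approach a bounded neighborhood of the consensus manifold, i.e. $\limsup_{t\to\infty}\|E_{\mathcal H}^{(t)}\|_{D_{\mathcal H}}$ is at most the second term on the right-hand side.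
   Context: Network. $\mathcal G=(\mathcal V,\mathcal E)$ is an undirected connected (simple) graph on $\mathcal V=\{1,\dots,n\}$; $\mathcal N_i=\{j\in\mathcal V:(i,j)\in\mathcal E\}$. $\mathcal V$ is the disjoint union of the (nonempty) set $\mathcal H$ of honest nodes and the set $\mathcal B$ of Byzantine nodes. At each time $t=0,1,2,\dots$ every honest node $i$ holds a state $x_i^{(t)}\in\mathbb R^d$ and receives a message $x_{j\to i}^{(t)}\in\mathbb R^d$ from each neighbor $j\in\mathcal N_i$. If $j\in\mathcal H$, then $x_{j\to i}^{(t)}=x_j^{(t)}$. If $j\in\mathcal B$, then $x_{j\to i}^{(t)}$ is arbitrary (may vary arbitrarily with $t$ and with the recipient $i$). $\|\cdot\|$ is the Euclidean norm. A-RepC iteration. Parameters: step size $\alpha$, inverse temperature $\eta$, forgetting factor $\lambda$. Starting from arbitrary $x_i^{(0)}$ and $L_{ij}^{(-1)}=0$, for every $i\in\mathcal H$, $j\in\mathcal N_i$ and $t\ge0$: - $(\mathrm{cm}_i^{(t)})_k=\operatorname{median}\{(x_{j\to i}^{(t)})_k: j\in\mathcal N_i\}$, $k=1,\dots,d$ (coordinate-wise median of the family of received messages, with multiplicity; usual median, the average of the two middle order statistics for an even number of values); - $l_{ij}^{(t)}=\|x_{j\to i}^{(t)}-\mathrm{cm}_i^{(t)}\|_\infty$ and $L_{ij}^{(t)}=\lambda L_{ij}^{(t-1)}+l_{ij}^{(t)}$; - $(p_{ij}^{(t)})_{j\in\mathcal N_i}=\operatorname{sparsemax}\big((-\eta L_{ij}^{(t)})_{j\in\mathcal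 N_i}\big)$, where for $z\in\mathbb R^K$, $\operatorname{sparsemax}(z)=\arg\max_{p\in\Delta^{K-1}}\{p^\top z-\tfrac12\|p\|^2\}$ and $\Delta^{K-1}=\{p\in\mathbb R^K:p\ge0,\ \sum_i p_i=1\}$; - $x_i^{(t+1)}=(1-\alpha)x_i^{(t)}+\alpha\sum_{j\in\mathcal N_i}p_{ij}^{(t)}x_{j\to i}^{(t)}$. Constants and disagreement. $d_i^{\mathcal H}=|\mathcal N_i\cap\mathcal H|$, $d_{\min}^{\mathcal H}=\min_{i\in\mathcal H}d_i^{\mathcal H}$, $d_{\max}^{\mathcal H}=\max_{i\in\mathcal H}d_i^{\mathcal H}$. $m_{\mathcal B\to\mathcal H}=|\{(j,i):i\in\mathcal H,\ j\in\mathcal N_i\cap\mathcal B\}|$ and $n_\Xi=|\mathcal H|+m_{\mathcal B\to\mathcal H}$. $A_{\mathcal H}$ is the adjacency matrix of the subgraph induced by $\mathcal H$, $D_{\mathcal H}=\operatorname{diag}(d_i^{\mathcal H})_{i\in\mathcal H}$, and $L_{\mathrm{sym},\mathcal H}=I-D_{\mathcal H}^{-1/2}A_{\mathcal H}D_{\mathcal H}^{-1/2}$ has eigenvalues $0=\mu_1<\mu_2\le\dots\le\mu_{|\mathcal H|}\le2$. For $\alpha\in(0,1)$, $\rho_0=\max_{\ell=2,\dots,|\mathcal H|}|1-\alpha\mu_\ell|$. The vector $\pi\in\mathbb R^{|\mathcal H|}$ is $\pi_i=d_i^{\mathcal H}/\sum_{\ell\in\mathcal H}d_\ell^{\mathcal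 H}$. With $X_{\mathcal H}^{(t)}=(x_i^{(t)})_{i\in\mathcal H}\in\mathbb R^{|\mathcal H|d}$ the stacked honest state, $$E_{\mathcal H}^{(t)}=\big((I_{|\mathcal H|}-\mathbf 1\pi^\top)\otimes I_d\big)X_{\mathcal H}^{(t)},\qquad \|Z\|_{D_{\mathcal H}}=\|(D_{\mathcal H}^{1/2}\otimes I_d)Z\|_2 .$$ $M_{\mathcal H}=\max_{i\in\mathcal H}\|x_i^{(0)}\|$, $M=\max\{M_{\mathcal H},M_{\mathcal B}\}$, and $$C_1=2M\sqrt{\frac{n_\Xi\, d_{\max}^{\mathcal H}}{d_{\min}^{\mathcal H}}\sum_{i\in\mathcal H}|\mathcal N_i|},\qquad C_2=\frac{2\sqrt{n_\Xi\, d_{\max}^{\mathcal H}\, m_{\mathcal B\to\mathcal H}\sum_{i\in\mathcal H}|\mathcal N_i|}}{d_{\min}^{\mathcal H}}.$$ *)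

theory Defs
  imports
    "HOL-Analysis.Analysis"
    "Jordan_Normal_Form.Char_Poly"
    "Graph_Theory.Digraph_Component"
begin

(* An undirected simple graph is a symmetric loop-free finite digraph (locale pair_graph):
   the edge {i, j} is represented by the two arcs (i, j) and (j, i). *)
definition nbrs :: "nat pair_pre_digraph \<Rightarrow> nat \<Rightarrow> nat set" where
  "nbrs G i = {j. (i, j) \<in> parcs G}"

(* For k sorted values s_0 \<le> ... \<le> s_{k-1}, the two indices below coincide when k is odd
   and are those of the two middle order statistics when k is even. *)
definition median :: "real multiset \<Rightarrow> real" where
  "median S = (let s = sorted_list_of_multiset S; k = size S
     in (s ! ((k - 1) div 2) + s ! (k div 2)) / 2)"

(* The simplex with coordinates indexed by the finite set K.  Coordinates outside K are set to 0,
   so that its points correspond exactly to the families (p_j)_{j \<in> K}. *)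
definition prob_simplex :: "'i set \<Rightarrow> ('i \<Rightarrow> real) set" where
  "prob_simplex K = {p. (\<forall>j\<in>K. 0 \<le> p j) \<and> (\<Sum>j\<in>K. p j) = 1 \<and> (\<forall>j. j \<notin> K \<longrightarrow> p j = 0)}"

(* For finite nonempty K the objective is strictly concave, so the maximiser is unique. *)
definition sparsemax :: "'i set \<Rightarrow> ('i \<Rightarrow> real) \<Rightarrow> 'i \<Rightarrow> real" where
  "sparsemax K z =
     arg_max (\<lambda>p. (\<Sum>j\<in>K. p j * z j) - 1/2 * (\<Sum>j\<in>K. (p j)\<^sup>2)) (\<lambda>p. p \<in> prob_simplex K)"

(* In the following, msg t j i is the message received by node i from its neighbour j at time t,
   and x t i is the state of node i at time t. *)

definition cw_median ::
  "nat pair_pre_digraph \<Rightarrow> (nat \<Rightarrow> nat \<Rightarrow> nat \<Rightarrow> real ^ 'd) \<Rightarrow> nat \<Rightarrow> nat \<Rightarrow> real ^ 'd" where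
  "cw_median G msg t i = (\<chi> k. median (image_mset (\<lambda>j. msg t j i $ k) (mset_set (nbrs G i))))"

definition loss ::
  "nat pair_pre_digraph \<Rightarrow> (nat \<Rightarrow> nat \<Rightarrow> nat \<Rightarrow> real ^ 'd) \<Rightarrow> nat \<Rightarrow> nat \<Rightarrow> nat \<Rightarrow> real" where
  "loss G msg i j t = infnorm (msg t j i - cw_median G msg t i)"

(* L^(t) = lam * L^(t-1) + l^(t) with L^(-1) = 0. *)
primrec cum_loss :: "real \<Rightarrow> (nat \<Rightarrow> real) \<Rightarrow> nat \<Rightarrow> real" where
  "cum_loss lam l 0 = l 0"
| "cum_loss lam l (Suc t) = lam * cum_loss lam l t + l (Suc t)"

definition weight ::
  "nat pair_pre_digraph \<Rightarrow> real \<Rightarrow> real \<Rightarrow> (nat \<Rightarrow> nat \<Rightarrow> nat \<Rightarrow> real ^ 'd)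
    \<Rightarrow> nat \<Rightarrow> nat \<Rightarrow> nat \<Rightarrow> real" where
  "weight G eta lam msg t i =
     sparsemax (nbrs G i) (\<lambda>j. - eta * cum_loss lam (loss G msg i j) t)"

(* Only the states of the nodes in H, and the messages they receive, are constrained; messages
   from neighbours outside H are arbitrary functions of time, sender and recipient. *)
definition A_RepC ::
  "nat pair_pre_digraph \<Rightarrow> nat set \<Rightarrow> real \<Rightarrow> real \<Rightarrow> real
    \<Rightarrow> (nat \<Rightarrow> nat \<Rightarrow> real ^ 'd) \<Rightarrow> (nat \<Rightarrow> nat \<Rightarrow> nat \<Rightarrow> real ^ 'd) \<Rightarrow> bool" where
  "A_RepC G H alpha eta lam x msg \<longleftrightarrow>
     (\<forall>t. \<forall>i\<in>H. \<forall>j\<in>nbrs G i \<inter> H. msg t j i = x t j) \<and>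
     (\<forall>t. \<forall>i\<in>H. x (Suc t) i =
        (1 - alpha) *\<^sub>R x t i + alpha *\<^sub>R (\<Sum>j\<in>nbrs G i. weight G eta lam msg t i j *\<^sub>R msg t j i))"

definition hdeg :: "nat pair_pre_digraph \<Rightarrow> nat set \<Rightarrow> nat \<Rightarrow> nat" where
  "hdeg G H i = card (nbrs G i \<inter> H)"

definition hdeg_min :: "nat pair_pre_digraph \<Rightarrow> nat set \<Rightarrow> nat" where
  "hdeg_min G H = Min (hdeg G H ` H)"

definition hdeg_max :: "nat pair_pre_digraph \<Rightarrow> nat set \<Rightarrow> nat" where
  "hdeg_max G H = Max (hdeg G H ` H)"

definition m_BH :: "nat pair_pre_digraph \<Rightarrow> nat set \<Rightarrow> nat set \<Rightarrow> nat" where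
  "m_BH G H B = card {(j, i). i \<in> H \<and> j \<in> nbrs G i \<inter> B}"

definition n_Xi :: "nat pair_pre_digraph \<Rightarrow> nat set \<Rightarrow> nat set \<Rightarrow> nat" where
  "n_Xi G H B = card H + m_BH G H B"

(* Matrices over H have their rows and columns listed in increasing order of the node. *)

definition hadj :: "nat pair_pre_digraph \<Rightarrow> nat set \<Rightarrow> real mat" where
  "hadj G H = (let h = sorted_list_of_set H
     in Matrix.mat (card H) (card H) (\<lambda>(a, b). if (h ! a, h ! b) \<in> parcs G then 1 else 0))"

definition hdeg_inv_sqrt :: "nat pair_pre_digraph \<Rightarrow> nat set \<Rightarrow> real mat" where
  "hdeg_inv_sqrt G H =
     mat_diag (card H) (\<lambda>a. 1 / sqrt (real (hdeg G H (sorted_list_of_set H ! a))))"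

definition L_sym :: "nat pair_pre_digraph \<Rightarrow> nat set \<Rightarrow> real mat" where
  "L_sym G H = 1\<^sub>m (card H) - hdeg_inv_sqrt G H * hadj G H * hdeg_inv_sqrt G H"

(* The eigenvalues with algebraic multiplicity, in increasing order and numbered from 1. *)
definition mu :: "nat pair_pre_digraph \<Rightarrow> nat set \<Rightarrow> nat \<Rightarrow> real" where
  "mu G H l = sorted_list_of_multiset (proots (char_poly (L_sym G H))) ! (l - 1)"

definition rho0 :: "nat pair_pre_digraph \<Rightarrow> nat set \<Rightarrow> real \<Rightarrow> real" where
  "rho0 G H alpha = Max ((\<lambda>l. \<bar>1 - alpha * mu G H l\<bar>) ` {2..card H})"

definition pi_vec :: "nat pair_pre_digraph \<Rightarrow> nat set \<Rightarrow> nat \<Rightarrow> real" where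
  "pi_vec G H i = real (hdeg G H i) / (\<Sum>l\<in>H. real (hdeg G H l))"

(* Stacked vectors in R^(|H| d) are families of vectors in R^d indexed by H.  The i-th block of
   ((I - 1 pi^T) \<otimes> I_d) X is the i-th row of I - 1 pi^T applied to the blocks of X. *)
definition disagreement ::
  "nat pair_pre_digraph \<Rightarrow> nat set \<Rightarrow> (nat \<Rightarrow> real ^ 'd) \<Rightarrow> nat \<Rightarrow> real ^ 'd" where
  "disagreement G H X i = (\<Sum>l\<in>H. ((if i = l then 1 else 0) - pi_vec G H l) *\<^sub>R X l)"

definition norm_D ::
  "nat pair_pre_digraph \<Rightarrow> nat set \<Rightarrow> (nat \<Rightarrow> real ^ 'd) \<Rightarrow> real" where
  "norm_D G H Z = L2_set (\<lambda>i. norm (sqrt (real (hdeg G H i)) *\<^sub>R Z i)) H"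

definition M_const :: "nat set \<Rightarrow> (nat \<Rightarrow> real ^ 'd) \<Rightarrow> real \<Rightarrow> real" where
  "M_const H x0 MB = max (Max ((\<lambda>i. norm (x0 i)) ` H)) MB"

definition C1 :: "nat pair_pre_digraph \<Rightarrow> nat set \<Rightarrow> nat set \<Rightarrow> real \<Rightarrow> real" where
  "C1 G H B M =
     2 * M * sqrt (real (n_Xi G H B) * real (hdeg_max G H) / real (hdeg_min G H)
                   * (\<Sum>i\<in>H. real (card (nbrs G i))))"

definition C2 :: "nat pair_pre_digraph \<Rightarrow> nat set \<Rightarrow> nat set \<Rightarrow> real" where
  "C2 G H B =
     2 * sqrt (real (n_Xi G H B) * real (hdeg_max G H) * real (m_BH G H B)
               * (\<Sum>i\<in>H. real (card (nbrs G i)))) / real (hdeg_min G H)"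

end

theory Submission
  imports Defs
begin

text \<open>
  Honest nodes would reach consensus by averaging over their honest neighbours, and A-RepC is a
  perturbation of that averaging. Let \<open>e\<^sub>t\<close> be the weighted norm of the disagreement at time \<open>t\<close>.

  One step of the ideal averaging acts on the disagreement as \<open>I - alpha L_sym\<close> (after conjugation with
  \<open>D\<^sup>1\<^sup>/\<^sup>2\<close>), restricted to the complement of the kernel. It contracts by \<open>rho0\<close>
  (\<open>averaging_contracts\<close>). The reason is variational: the operator norm on the complement is attained, a maximiser
  yields an eigenvector (\<open>contraction_if_eigenvalues_bounded\<close>), and by connectivity the eigenvalue of \<open>L_sym\<close> is
  positive, hence one of \<open>mu 2, mu 3, \<dots>\<close> (\<open>eigenvalue_le_rho0\<close>).

  The perturbation is controlled through sparsemax, which is a projection onto the simplex. Comparing its value with the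
  uniform distribution on the honest neighbours of node \<open>i\<close>, the variational inequality of the projection
  bounds the distance by \<open>eta\<close> times the norm of the accumulated honest losses plus
  \<open>sqrt b\<^sub>i / d\<^sub>i\<close>, where \<open>b\<^sub>i\<close> and \<open>d\<^sub>i\<close> are the numbers of Byzantine and honest neighbours
  (\<open>sparsemax_distance_to_uniform\<close>). Byzantine losses drop out, since a large loss only lowers the
  weight of its sender. An honest loss is at most a constant times \<open>e\<^sub>t\<close>, because the median of a family
  with an honest majority stays in the range of the honest values (\<open>honest_loss_le\<close>). As all messages are bounded by \<open>M\<close>,
  the perturbation is at most \<open>eta C1 S\<^sub>t + C2 M\<close>, with \<open>S\<^sub>t\<close> the discounted sum of \<open>e\<^sub>0, \<dots>, e\<^sub>t\<close>
  (\<open>norm_D_perturbation_le\<close>).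

  Altogether \<open>e\<^sub>t\<^sub>+\<^sub>1 \<le> rho0 e\<^sub>t + alpha eta C1 S\<^sub>t + alpha C2 M\<close> (\<open>err_recursion\<close>). The step size condition says
  that the gain of the memory loop, \<open>alpha eta C1 / (1 - lam)\<close>, is smaller than the damping \<open>1 - rho0\<close>, so the
  system is a stable one and \<open>e\<^sub>t\<close> decays geometrically, with \<open>kappa = 1\<close>, down to the fixed point of the recursion
  (\<open>geometric_decay_with_fading_memory\<close>).
\<close>

section \<open>Compactness in spaces of finitely supported families\<close>

text \<open>
  Extremisers of two problems over families indexed by a finite set are
  needed below: the maximiser that defines sparsemax, and a maximiser of a quadratic form on a sphere.
  Both come from compactness in the product topology on functions: fixing the values
  outside \<open>K\<close> to 0 makes a box a product of compact sets, so Tychonoff's theorem applies.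
\<close>

lemma compact_bounded_families:
  fixes K :: "'i set" and a b :: real
  shows "compact {w. (\<forall>i\<in>K. w i \<in> {a..b}) \<and> (\<forall>i. i \<notin> K \<longrightarrow> w i = 0)}"
proof -
  have "compactin (product_topology (\<lambda>i. euclidean) UNIV)
          (PiE UNIV (\<lambda>i. if i \<in> K then {a..b} else {0::real}))"
    by (subst compactin_PiE) auto
  moreover have "PiE UNIV (\<lambda>i. if i \<in> K then {a..b} else {0::real}) =
      {w. (\<forall>i\<in>K. w i \<in> {a..b}) \<and> (\<forall>i. i \<notin> K \<longrightarrow> w i = 0)}"
    by (auto simp: PiE_def Pi_def split: if_splits)
  ultimately show ?thesis
    by (simp add: euclidean_product_topology)
qed

lemma continuous_on_coordinate [continuous_intros]:
  "continuous_on S (\<lambda>w. w i :: real)"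
  by (rule continuous_on_subset[OF continuous_on_product_coordinates]) simp

section \<open>Sparsemax as a projection onto the simplex\<close>

lemma compact_prob_simplex:
  assumes "finite K"
  shows "compact (prob_simplex K)"
proof -
  have "p j \<le> 1" if "p \<in> prob_simplex K" "j \<in> K" for p j
    using member_le_sum[of j K p] that assms by (auto simp: prob_simplex_def)
  then have "prob_simplex K =
      {w. (\<forall>i\<in>K. w i \<in> {0..1}) \<and> (\<forall>i. i \<notin> K \<longrightarrow> w i = 0)} \<inter> {p. (\<Sum>j\<in>K. p j) = 1}"
    by (fastforce simp: prob_simplex_def)
  moreover have "closed {p::'a \<Rightarrow> real. (\<Sum>j\<in>K. p j) = 1}"
    by (intro closed_Collect_eq continuous_intros)
  ultimately show ?thesis
    by (simp only: compact_Int_closed[OF compact_bounded_families])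
qed

lemma uniform_in_prob_simplex:
  assumes "finite K" "A \<subseteq> K" "A \<noteq> {}"
  shows "(\<lambda>j. if j \<in> A then 1 / real (card A) else 0) \<in> prob_simplex K"
proof -
  have "finite A" using assms finite_subset by auto
  then show ?thesis
    using assms by (auto simp: prob_simplex_def sum.If_cases Int_absorb1 Int_absorb2)
qed

lemma sparsemax_maximises:
  assumes "finite K" "K \<noteq> {}"
  shows "is_arg_max (\<lambda>p. (\<Sum>j\<in>K. p j * z j) - 1/2 * (\<Sum>j\<in>K. (p j)\<^sup>2))
           (\<lambda>p. p \<in> prob_simplex K) (sparsemax K z)"
proof -
  let ?f = "\<lambda>p. (\<Sum>j\<in>K. p j * z j) - 1/2 * (\<Sum>j\<in>K. (p j)\<^sup>2)"
  have "prob_simplex K \<noteq> {}"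
    using uniform_in_prob_simplex[of K K] assms by auto
  moreover have "continuous_on (prob_simplex K) ?f"
    by (intro continuous_intros)
  ultimately obtain p where "p \<in> prob_simplex K" "\<forall>q\<in>prob_simplex K. ?f q \<le> ?f p"
    using continuous_attains_sup[OF compact_prob_simplex[OF assms(1)]] by blast
  then have "is_arg_max ?f (\<lambda>p. p \<in> prob_simplex K) p"
    by (auto simp: is_arg_max_def not_less)
  then show ?thesis
    unfolding sparsemax_def arg_max_def by (rule someI[of "is_arg_max ?f (\<lambda>p. p \<in> prob_simplex K)"])
qed

lemma sparsemax_in_prob_simplex:
  "finite K \<Longrightarrow> K \<noteq> {} \<Longrightarrow> sparsemax K z \<in> prob_simplex K"
  using sparsemax_maximises[of K z] by (auto simp: is_arg_max_def)

text \<open>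
  First-order optimality in one variable: divide by \<open>s\<close> and let \<open>s\<close> tend to 0.
\<close>

lemma nonpos_if_linear_le_quadratic:
  fixes a b :: real
  assumes "\<And>s. 0 < s \<Longrightarrow> s \<le> 1 \<Longrightarrow> s * a \<le> s\<^sup>2 * b"
  shows "a \<le> 0"
proof (rule ccontr)
  assume "\<not> a \<le> 0"
  define s where "s = min 1 (a / (2 * (\<bar>b\<bar> + 1)))"
  have s: "0 < s" "s \<le> 1" using \<open>\<not> a \<le> 0\<close> by (auto simp: s_def)
  have "s * a \<le> s * (s * b)" using assms[OF s] by (simp add: power2_eq_square)
  then have "a \<le> s * b" using s by simp
  also have "\<dots> \<le> s * (\<bar>b\<bar> + 1)" using s by (intro mult_left_mono) auto
  also have "\<dots> \<le> a / (2 * (\<bar>b\<bar> + 1)) * (\<bar>b\<bar> + 1)"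
    by (intro mult_right_mono) (auto simp: s_def)
  also have "\<dots> = a / 2" by (simp add: field_simps)
  finally show False using \<open>\<not> a \<le> 0\<close> by simp
qed

text \<open>
  Up to a term independent of \<open>p\<close>, the objective of sparsemax is \<open>- 1/2\<close> times the squared distance
  of \<open>p\<close> to \<open>z\<close>, so sparsemax is the Euclidean projection of \<open>z\<close>. The inequality is the obtuse-angle
  characterisation of that projection; it follows by moving from \<open>p\<close> a little towards \<open>u\<close>.
\<close>

lemma sparsemax_variational_inequality:
  fixes z :: "'i \<Rightarrow> real"
  assumes K: "finite K" "K \<noteq> {}" and u: "u \<in> prob_simplex K"
  defines "p \<equiv> sparsemax K z"
  shows "(\<Sum>j\<in>K. (z j - p j) * (u j - p j)) \<le> 0"
proof (rule nonpos_if_linear_le_quadratic)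
  fix s :: real
  assume s: "0 < s" "s \<le> 1"
  let ?f = "\<lambda>p. (\<Sum>j\<in>K. p j * z j) - 1/2 * (\<Sum>j\<in>K. (p j)\<^sup>2)"
  define q where "q = (\<lambda>j. p j + s * (u j - p j))"
  have p: "p \<in> prob_simplex K"
    unfolding p_def using K by (rule sparsemax_in_prob_simplex)
  have q_alt: "q j = (1 - s) * p j + s * u j" for j
    by (simp add: q_def algebra_simps)
  have "(\<Sum>j\<in>K. q j) = (1 - s) * (\<Sum>j\<in>K. p j) + s * (\<Sum>j\<in>K. u j)"
    by (simp add: q_alt sum.distrib sum_distrib_left)
  then have "q \<in> prob_simplex K"
    using p u s by (auto simp: prob_simplex_def q_alt)
  then have "?f q \<le> ?f p"
    using sparsemax_maximises[OF K, of z] unfolding p_def by (auto simp: is_arg_max_def not_less)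
  moreover have "?f q = ?f p + s * (\<Sum>j\<in>K. (z j - p j) * (u j - p j))
      - s\<^sup>2 * ((\<Sum>j\<in>K. (u j - p j)\<^sup>2) / 2)"
  proof -
    have f_sum: "?f w = (\<Sum>j\<in>K. w j * z j - (w j)\<^sup>2 / 2)" for w
      by (simp add: sum_subtractf sum_distrib_left sum_divide_distrib)
    have "q j * z j - (q j)\<^sup>2 / 2 = (p j * z j - (p j)\<^sup>2 / 2)
        + s * ((z j - p j) * (u j - p j)) - s\<^sup>2 * ((u j - p j)\<^sup>2 / 2)" for j
      by (simp add: q_def power2_eq_square field_simps)
    then show ?thesis
      unfolding f_sum sum_divide_distrib sum_distrib_left sum.distrib[symmetric] sum_subtractf[symmetric]
      by (intro sum.cong) auto
  qed
  ultimately show "s * (\<Sum>j\<in>K. (z j - p j) * (u j - p j)) \<le> s\<^sup>2 * ((\<Sum>j\<in>K. (u j - p j)\<^sup>2) / 2)"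
    by simp
qed

text \<open>
  Comparison with the uniform distribution \<open>u\<close> on the honest senders \<open>A\<close>. The variational inequality gives
  \<open>|p - u|\<^sup>2 \<le> \<langle>z - u, p - u\<rangle>\<close>. In this inner product the scores of the Byzantine senders \<open>B\<close> enter
  with the favourable sign, because \<open>u\<close> vanishes and \<open>z \<le> 0\<close> there. What remains are the losses on \<open>A\<close> and
  the Byzantine mass \<open>p(B)\<close> divided by \<open>card A\<close>; both are at most a constant times \<open>|p - u|\<close>
  by Cauchy--Schwarz, and one factor \<open>|p - u|\<close> cancels. Hence the bound is linear in the honest
  losses and free of the Byzantine ones.
\<close>

lemma sparsemax_distance_to_uniform:
  fixes A B :: "'i set" and L :: "'i \<Rightarrow> real"
  assumes fin: "finite A" "finite B" and "A \<inter> B = {}" "A \<noteq> {}"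
    and L: "\<And>j. j \<in> B \<Longrightarrow> 0 \<le> L j" and eta: "0 \<le> eta"
  defines "p \<equiv> sparsemax (A \<union> B) (\<lambda>j. - eta * L j)"
    and "u \<equiv> (\<lambda>j. if j \<in> A then 1 / real (card A) else 0)"
  shows "L2_set (\<lambda>j. p j - u j) (A \<union> B) \<le> eta * L2_set L A + sqrt (card B) / card A"
proof -
  let ?K = "A \<union> B" and ?z = "\<lambda>j. - eta * L j"
  define r where "r = L2_set (\<lambda>j. p j - u j) ?K"
  have K: "finite ?K" "?K \<noteq> {}" using assms by auto
  have p: "p \<in> prob_simplex ?K" unfolding p_def using K by (rule sparsemax_in_prob_simplex)
  have u: "u \<in> prob_simplex ?K" unfolding u_def using K \<open>A \<noteq> {}\<close> by (intro uniform_in_prob_simplex) auto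
  have r0: "0 \<le> r" by (simp add: r_def)
  have sub: "L2_set (\<lambda>j. p j - u j) C \<le> r" if "C \<subseteq> ?K" for C
    unfolding r_def L2_set_def using that K by (intro real_sqrt_le_mono sum_mono2) auto
  have "r\<^sup>2 = (\<Sum>j\<in>?K. (p j - u j)\<^sup>2)"
    by (simp add: r_def L2_set_def sum_nonneg)
  also have "\<dots> \<le> (\<Sum>j\<in>?K. (?z j - u j) * (p j - u j))"
  proof -
    have "(\<Sum>j\<in>?K. (p j - u j)\<^sup>2) = (\<Sum>j\<in>?K. (?z j - u j) * (p j - u j))
        + (\<Sum>j\<in>?K. (?z j - p j) * (u j - p j))"
      unfolding sum.distrib[symmetric]
      by (intro sum.cong) (auto simp: power2_eq_square algebra_simps)
    then show ?thesis
      using sparsemax_variational_inequality[OF K u, of ?z] unfolding p_def by simp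
  qed
  also have "\<dots> = eta * (\<Sum>j\<in>A. L j * (u j - p j)) - eta * (\<Sum>j\<in>B. L j * p j)
      + (\<Sum>j\<in>B. p j) / card A"
  proof -
    have "(\<Sum>j\<in>A. (?z j - u j) * (p j - u j)) =
        eta * (\<Sum>j\<in>A. L j * (u j - p j)) - (\<Sum>j\<in>A. p j - u j) / card A"
      unfolding sum_distrib_left sum_divide_distrib sum_subtractf[symmetric]
      by (intro sum.cong) (auto simp: u_def algebra_simps diff_divide_distrib)
    moreover have "(\<Sum>j\<in>B. (?z j - u j) * (p j - u j)) = - eta * (\<Sum>j\<in>B. L j * p j)"
      unfolding sum_distrib_left using \<open>A \<inter> B = {}\<close>
      by (intro sum.cong) (auto simp: u_def)
    moreover have "(\<Sum>j\<in>A. p j - u j) = - (\<Sum>j\<in>B. p j)"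
    proof -
      have "(\<Sum>j\<in>A. p j) + (\<Sum>j\<in>B. p j) = 1"
        using p sum.union_disjoint[OF fin \<open>A \<inter> B = {}\<close>, of p] by (simp add: prob_simplex_def)
      moreover have "(\<Sum>j\<in>A. u j) = 1"
        using fin \<open>A \<noteq> {}\<close> by (simp add: u_def)
      ultimately show ?thesis by (simp add: sum_subtractf)
    qed
    ultimately show ?thesis
      by (simp add: sum.union_disjoint[OF fin \<open>A \<inter> B = {}\<close>])
  qed
  also have "\<dots> \<le> eta * (L2_set L A * r) + sqrt (card B) * r / card A"
  proof -
    have "(\<Sum>j\<in>A. L j * (u j - p j)) \<le> (\<Sum>j\<in>A. \<bar>L j\<bar> * \<bar>p j - u j\<bar>)"
      by (intro sum_mono) (metis abs_ge_self abs_minus_commute abs_mult)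
    also have "\<dots> \<le> L2_set L A * L2_set (\<lambda>j. p j - u j) A"
      by (rule L2_set_mult_ineq)
    also have "\<dots> \<le> L2_set L A * r"
      by (intro mult_left_mono sub) auto
    finally have 1: "eta * (\<Sum>j\<in>A. L j * (u j - p j)) \<le> eta * (L2_set L A * r)"
      using eta by (rule mult_left_mono)
    have "(\<Sum>j\<in>B. p j) \<le> (\<Sum>j\<in>B. \<bar>1\<bar> * \<bar>p j - u j\<bar>)"
      using \<open>A \<inter> B = {}\<close> by (intro sum_mono) (auto simp: u_def)
    also have "\<dots> \<le> L2_set (\<lambda>_. 1) B * L2_set (\<lambda>j. p j - u j) B"
      by (rule L2_set_mult_ineq)
    also have "\<dots> \<le> sqrt (card B) * r"
      by (intro mult_mono sub) (auto simp: L2_set_def sum_nonneg)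
    finally have 2: "(\<Sum>j\<in>B. p j) / card A \<le> sqrt (card B) * r / card A"
      by (rule divide_right_mono) simp
    have "0 \<le> eta * (\<Sum>j\<in>B. L j * p j)"
      using eta L p by (intro mult_nonneg_nonneg sum_nonneg) (auto simp: prob_simplex_def)
    with 1 2 show ?thesis by linarith
  qed
  finally have "r * r \<le> r * (eta * L2_set L A + sqrt (card B) / card A)"
    by (simp add: power2_eq_square algebra_simps)
  moreover have "0 \<le> eta * L2_set L A + sqrt (card B) / card A"
    using eta by simp
  ultimately have "r \<le> eta * L2_set L A + sqrt (card B) / card A"
    using r0 by (cases "r = 0") auto
  then show ?thesis by (simp add: r_def)
qed

lemma sparsemax_average_error:
  fixes y :: "'i \<Rightarrow> 'v::real_normed_vector" and A B :: "'i set"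
  assumes fin: "finite A" "finite B" and AB: "A \<inter> B = {}" "A \<noteq> {}"
    and L: "\<And>j. j \<in> B \<Longrightarrow> 0 \<le> L j" and eta: "0 \<le> eta"
    and y: "\<And>j. j \<in> A \<union> B \<Longrightarrow> norm (y j) \<le> M" and M: "0 \<le> M"
  shows "norm ((\<Sum>j\<in>A \<union> B. sparsemax (A \<union> B) (\<lambda>j. - eta * L j) j *\<^sub>R y j)
            - (1 / card A) *\<^sub>R (\<Sum>j\<in>A. y j))
         \<le> M * sqrt (card (A \<union> B)) * (eta * L2_set L A + sqrt (card B) / card A)"
proof -
  let ?K = "A \<union> B"
  define p where "p = sparsemax ?K (\<lambda>j. - eta * L j)"
  define u where "u = (\<lambda>j. if j \<in> A then 1 / real (card A) else 0)"
  have "(1 / card A) *\<^sub>R (\<Sum>j\<in>A. y j) = (\<Sum>j\<in>?K. u j *\<^sub>R y j)"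
  proof -
    have "(\<Sum>j\<in>?K. u j *\<^sub>R y j) = (\<Sum>j\<in>A. u j *\<^sub>R y j)"
      using fin by (intro sum.mono_neutral_right) (auto simp: u_def)
    then show ?thesis by (simp add: u_def scaleR_sum_right)
  qed
  then have "norm ((\<Sum>j\<in>?K. p j *\<^sub>R y j) - (1 / card A) *\<^sub>R (\<Sum>j\<in>A. y j))
      = norm (\<Sum>j\<in>?K. (p j - u j) *\<^sub>R y j)"
    by (simp add: scaleR_left_diff_distrib sum_subtractf)
  also have "\<dots> \<le> (\<Sum>j\<in>?K. \<bar>p j - u j\<bar> * M)"
    by (rule sum_norm_le) (auto intro!: mult_left_mono y)
  also have "\<dots> = M * (\<Sum>j\<in>?K. \<bar>1\<bar> * \<bar>p j - u j\<bar>)"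
    by (simp add: sum_distrib_left mult.commute)
  also have "\<dots> \<le> M * (L2_set (\<lambda>_. 1) ?K * L2_set (\<lambda>j. p j - u j) ?K)"
    using M by (intro mult_left_mono L2_set_mult_ineq)
  also have "\<dots> \<le> M * (sqrt (card ?K) * (eta * L2_set L A + sqrt (card B) / card A))"
  proof (intro mult_left_mono mult_mono)
    show "L2_set (\<lambda>j. p j - u j) ?K \<le> eta * L2_set L A + sqrt (card B) / card A"
      unfolding p_def u_def by (rule sparsemax_distance_to_uniform[OF fin AB L eta])
  qed (use M eta in \<open>auto simp: L2_set_def sum_nonneg\<close>)
  finally show ?thesis by (simp add: p_def mult.assoc)
qed

section \<open>The median under an honest majority\<close>

text \<open>
  The conditions on \<open>k\<close> say that \<open>k\<close> is a middle index. If the entry there left \<open>[a, b]\<close>, then so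
  would all entries on one side of it, which are at least half of the list.
\<close>

lemma sorted_nth_bounds_if_majority:
  fixes s :: "real list"
  assumes "sorted s" and maj: "2 * length (filter (\<lambda>v. \<not> (a \<le> v \<and> v \<le> b)) s) < length s"
    and k: "k < length s" "length s \<le> 2 * Suc k" "2 * k \<le> length s"
  shows "a \<le> s ! k \<and> s ! k \<le> b"
proof (rule ccontr)
  assume out: "\<not> (a \<le> s ! k \<and> s ! k \<le> b)"
  let ?bad = "{i. i < length s \<and> \<not> (a \<le> s ! i \<and> s ! i \<le> b)}"
  have card_bad: "2 * card ?bad < length s"
    using maj by (simp add: length_filter_conv_card)
  show False
  proof (cases "s ! k < a")
    case True
    have "s ! i < a" if "i \<le> k" for i
      using sorted_nth_mono[OF \<open>sorted s\<close> that k(1)] True by simp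
    then have "{..k} \<subseteq> ?bad" using k(1) by fastforce
    then have "card {..k} \<le> card ?bad" by (intro card_mono) auto
    with card_bad k(2) show False by simp
  next
    case False
    with out have "b < s ! k" by simp
    have "b < s ! i" if "k \<le> i" "i < length s" for i
      using sorted_nth_mono[OF \<open>sorted s\<close> that] \<open>b < s ! k\<close> by simp
    then have "{k..<length s} \<subseteq> ?bad" by fastforce
    then have "card {k..<length s} \<le> card ?bad" by (intro card_mono) auto
    with card_bad k(3) show False by simp
  qed
qed

lemma median_bounds_if_majority:
  assumes maj: "2 * size (filter_mset (\<lambda>v. \<not> (a \<le> v \<and> v \<le> b)) S) < size S"
  shows "a \<le> median S" "median S \<le> b"
proof -
  define s where "s = sorted_list_of_multiset S"
  have S: "S = mset s" by (simp add: s_def)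
  have len: "length s = size S" by (simp add: S)
  have "length (filter (\<lambda>v. \<not> (a \<le> v \<and> v \<le> b)) s) = size (filter_mset (\<lambda>v. \<not> (a \<le> v \<and> v \<le> b)) S)"
    by (simp add: S flip: mset_filter)
  then have *: "2 * length (filter (\<lambda>v. \<not> (a \<le> v \<and> v \<le> b)) s) < length s"
    using maj len by simp
  have "sorted s" by (simp add: s_def)
  note nth = sorted_nth_bounds_if_majority[OF this *]
  have "length s > 0" using * by linarith
  then have "a \<le> s ! ((length s - 1) div 2) \<and> s ! ((length s - 1) div 2) \<le> b"
    by (intro nth) arith+
  moreover have "a \<le> s ! (length s div 2) \<and> s ! (length s div 2) \<le> b"
    using \<open>length s > 0\<close> by (intro nth) auto
  ultimately show "a \<le> median S" "median S \<le> b"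
    unfolding median_def Let_def by (auto simp: len s_def[symmetric])
qed

section \<open>Operators that are self-adjoint for a weighted inner product\<close>

text \<open>
  The expansion of a nonnegative quadratic form around one of its zeros has no linear term.
\<close>

lemma nonneg_form_minimum:
  fixes b c :: real
  assumes "\<And>s. 0 \<le> 2 * s * b + s\<^sup>2 * c"
  shows "b = 0"
proof -
  have "s * (- 2 * b) \<le> s\<^sup>2 * c" "s * (2 * b) \<le> s\<^sup>2 * c" for s
    using assms[of s] assms[of "- s"] by (auto simp: algebra_simps)
  then have "- 2 * b \<le> 0" "2 * b \<le> 0"
    using nonpos_if_linear_le_quadratic[of "- 2 * b" c] nonpos_if_linear_le_quadratic[of "2 * b" c]
    by blast+
  then show ?thesis by simp
qed

text \<open>
  This is the variational part of the spectral theorem. Among the vectors of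
  weighted norm 1 that are orthogonal to the constants, let \<open>w\<close> maximise \<open>|T w|\<close>, with maximum \<open>s\<close>.
  The form \<open>s\<^sup>2 |x|\<^sup>2 - |T x|\<^sup>2\<close> is nonnegative on that subspace and zero at \<open>w\<close>, so its derivative there vanishes;
  as \<open>T\<close> is self-adjoint and preserves the subspace, this says \<open>T (T w) = s\<^sup>2 w\<close>.
  Factoring \<open>T\<^sup>2 - s\<^sup>2 = (T - s) (T + s)\<close> shows that \<open>s\<close> or \<open>- s\<close> is an eigenvalue of \<open>T\<close> with an
  eigenvector in the subspace.
\<close>

lemma contraction_if_eigenvalues_bounded:
  fixes d :: "'i \<Rightarrow> real" and a :: "'i \<Rightarrow> 'i \<Rightarrow> real"
  assumes fin: "finite K"
    and d: "\<And>i. i \<in> K \<Longrightarrow> 0 < d i"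
    and sym: "\<And>i j. i \<in> K \<Longrightarrow> j \<in> K \<Longrightarrow> d i * a i j = d j * a j i"
    and rows: "\<And>i. i \<in> K \<Longrightarrow> (\<Sum>j\<in>K. a i j) = 1"
    and eig: "\<And>th u. (\<And>i. i \<in> K \<Longrightarrow> (\<Sum>j\<in>K. a i j * u j) = th * u i) \<Longrightarrow>
        (\<Sum>i\<in>K. d i * u i) = 0 \<Longrightarrow> \<exists>i\<in>K. u i \<noteq> 0 \<Longrightarrow> \<bar>th\<bar> \<le> r"
    and v: "(\<Sum>i\<in>K. d i * v i) = 0"
  shows "(\<Sum>i\<in>K. d i * (\<Sum>j\<in>K. a i j * v j)\<^sup>2) \<le> r\<^sup>2 * (\<Sum>i\<in>K. d i * (v i)\<^sup>2)"
proof -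
  define ip where "ip u w = (\<Sum>i\<in>K. d i * u i * w i)" for u w :: "'i \<Rightarrow> real"
  define T where "T w i = (\<Sum>j\<in>K. a i j * w j)" for w i
  have ip_comm: "ip u w = ip w u" for u w
    by (simp add: ip_def mult.assoc mult.commute[of "u _"])
  have ip_lin: "ip u (\<lambda>i. w i + s * w' i) = ip u w + s * ip u w'" for u w w' s
    by (simp add: ip_def algebra_simps sum.distrib sum_distrib_left)
  have T_lin: "T (\<lambda>i. w i + s * w' i) = (\<lambda>i. T w i + s * T w' i)" for w w' s
    by (rule ext) (simp add: T_def algebra_simps sum.distrib sum_distrib_left)
  have ip_cong: "ip u w = ip u' w'" if "\<And>i. i \<in> K \<Longrightarrow> u i = u' i" "\<And>i. i \<in> K \<Longrightarrow> w i = w' i" for u w u' w'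
    using that by (simp add: ip_def)
  have T_cong: "T w = T w'" if "\<And>i. i \<in> K \<Longrightarrow> w i = w' i" for w w'
    using that by (auto simp: T_def intro!: ext sum.cong)
  have self_adj: "ip (T u) w = ip u (T w)" for u w
  proof -
    have "ip (T u) w = (\<Sum>i\<in>K. \<Sum>j\<in>K. d i * a i j * u j * w i)"
      by (simp add: ip_def T_def sum_distrib_left sum_distrib_right mult.assoc)
    also have "\<dots> = (\<Sum>i\<in>K. \<Sum>j\<in>K. d j * a j i * u j * w i)"
      by (intro sum.cong refl) (simp add: sym)
    also have "\<dots> = (\<Sum>j\<in>K. \<Sum>i\<in>K. d j * a j i * u j * w i)"
      by (rule sum.swap)
    also have "\<dots> = ip u (T w)"
      by (simp add: ip_def T_def sum_distrib_left mult_ac)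
    finally show ?thesis .
  qed
  have ip_one: "ip w (\<lambda>_. 1) = (\<Sum>i\<in>K. d i * w i)" for w
    by (simp add: ip_def)
  have T_perp: "ip (T w) (\<lambda>_. 1) = ip w (\<lambda>_. 1)" for w
    unfolding self_adj by (rule ip_cong) (simp_all add: T_def rows)
  have ip_sq: "ip w w = (\<Sum>i\<in>K. d i * (w i)\<^sup>2)" for w
    by (simp add: ip_def power2_eq_square mult.assoc)
  have ip_nonneg: "0 \<le> ip w w" for w
    unfolding ip_sq by (intro sum_nonneg mult_nonneg_nonneg) (auto intro: less_imp_le d)
  have ip_zero: "w i = 0" if "ip w w = 0" "i \<in> K" for w i
  proof -
    have "0 \<le> d i * (w i)\<^sup>2" if "i \<in> K" for i
      using d[OF that] by simp
    then have "\<forall>i\<in>K. d i * (w i)\<^sup>2 = 0"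
      using that(1) iffD1[OF sum_nonneg_eq_0_iff[OF fin, of "\<lambda>i. d i * (w i)\<^sup>2"]]
      unfolding ip_sq by blast
    then show ?thesis using d[OF that(2)] that(2) by auto
  qed
  show ?thesis
  proof (cases "ip v v = 0")
    case True
    then have "v i = 0" if "i \<in> K" for i using ip_zero that by blast
    then show ?thesis by simp
  next
    case False
    \<comment> \<open>Coordinates outside \<open>K\<close> are irrelevant to \<open>ip\<close> and \<open>T\<close>; setting them to 0 puts the sphere into a compact box.\<close>
    define S where "S = {w. (\<forall>i. i \<notin> K \<longrightarrow> w i = 0) \<and> ip w w = 1 \<and> ip w (\<lambda>_. 1) = 0}"
    define nrm where "nrm w = (\<lambda>i. if i \<in> K then w i / sqrt (ip w w) else 0)" for w
    have nrm_ip: "ip (nrm w) z = ip w z / sqrt (ip w w)" for w z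
      by (simp add: ip_def nrm_def sum_divide_distrib)
    have nrm_S: "nrm w \<in> S" if "ip w w \<noteq> 0" "ip w (\<lambda>_. 1) = 0" for w
    proof -
      have "ip (nrm w) (nrm w) = ip w w / (sqrt (ip w w))\<^sup>2"
        by (simp add: nrm_ip ip_comm[of w "nrm w"] power2_eq_square)
      then have "ip (nrm w) (nrm w) = 1"
        using that(1) ip_nonneg[of w] by simp
      then show ?thesis
        using that by (simp add: S_def nrm_ip) (simp add: nrm_def)
    qed
    have nrm_T: "ip (T (nrm w)) (T (nrm w)) = ip (T w) (T w) / ip w w" for w
    proof -
      have "T (nrm w) = (\<lambda>i. T w i / sqrt (ip w w))"
        by (rule ext) (simp add: T_def nrm_def sum_divide_distrib)
      then have "ip (T (nrm w)) (T (nrm w)) = ip (T w) (T w) / (sqrt (ip w w))\<^sup>2"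
        by (simp add: ip_def sum_divide_distrib power2_eq_square)
      then show ?thesis using ip_nonneg[of w] by simp
    qed
    have "compact S"
    proof -
      define c where "c = sqrt (\<Sum>i\<in>K. 1 / d i)"
      have "\<bar>w i\<bar> \<le> c" if "ip w w = 1" "i \<in> K" for w i
      proof -
        have "d i * (w i)\<^sup>2 \<le> 1"
          using member_le_sum[of i K "\<lambda>i. d i * (w i)\<^sup>2"] that fin d
          by (simp add: ip_sq less_imp_le)
        then have "(w i)\<^sup>2 \<le> 1 / d i" using d[OF that(2)] by (simp add: field_simps)
        also have "\<dots> \<le> (\<Sum>i\<in>K. 1 / d i)"
          using that fin d by (intro member_le_sum) (auto simp: less_imp_le)
        finally have "sqrt ((w i)\<^sup>2) \<le> c" unfolding c_def by (rule real_sqrt_le_mono)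
        then show ?thesis by simp
      qed
      then have "S = {w. (\<forall>i\<in>K. w i \<in> {- c..c}) \<and> (\<forall>i. i \<notin> K \<longrightarrow> w i = 0)}
          \<inter> ({w. ip w w = 1} \<inter> {w. ip w (\<lambda>_. 1) = 0})"
        by (fastforce simp: S_def abs_le_iff)
      moreover have "closed ({w. ip w w = 1} \<inter> {w. ip w (\<lambda>_. 1) = 0})"
        unfolding ip_def by (intro closed_Int closed_Collect_eq continuous_intros)
      ultimately show ?thesis
        by (simp only: compact_Int_closed[OF compact_bounded_families])
    qed
    moreover have "nrm v \<in> S" using False v by (intro nrm_S) (simp_all add: ip_one)
    moreover have "continuous_on S (\<lambda>w. ip (T w) (T w))"
      unfolding ip_def T_def by (intro continuous_intros)
    ultimately obtain w where w: "w \<in> S" and w_max: "\<And>z. z \<in> S \<Longrightarrow> ip (T z) (T z) \<le> ip (T w) (T w)"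
      using continuous_attains_sup[of S "\<lambda>w. ip (T w) (T w)"] by blast
    define s where "s = sqrt (ip (T w) (T w))"
    have s: "0 \<le> s" "s\<^sup>2 = ip (T w) (T w)" using ip_nonneg by (auto simp: s_def)
    have bound: "ip (T z) (T z) \<le> s\<^sup>2 * ip z z" if "ip z (\<lambda>_. 1) = 0" for z
    proof (cases "ip z z = 0")
      case True
      then have "T z = (\<lambda>_. 0)" by (auto simp: T_def ip_zero intro!: ext sum.neutral)
      then show ?thesis using True by (simp add: ip_def)
    next
      case False
      then have "ip (T z) (T z) / ip z z \<le> s\<^sup>2"
        using w_max[OF nrm_S[OF False that]] s by (simp add: nrm_T)
      then show ?thesis using False ip_nonneg[of z] by (simp add: divide_le_eq)
    qed
    \<comment> \<open>The residual of the eigenvector equation is itself an admissible direction of variation.\<close>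
    define g where "g = (\<lambda>i. T (T w) i + (- s\<^sup>2) * w i)"
    have w1: "ip w (\<lambda>_. 1) = 0" "ip w w = 1" using w by (auto simp: S_def)
    have perp_lin: "ip (\<lambda>i. x i + c * y i) (\<lambda>_. 1) = 0" if "ip x (\<lambda>_. 1) = 0" "ip y (\<lambda>_. 1) = 0" for x y c
      using that ip_lin[of "\<lambda>_. 1" x c y] by (simp add: ip_comm[of _ "\<lambda>_. 1"])
    have g1: "ip g (\<lambda>_. 1) = 0"
      unfolding g_def by (rule perp_lin) (simp_all add: T_perp w1)
    have "s\<^sup>2 * ip w g - ip (T w) (T g) = 0"
    proof (rule nonneg_form_minimum)
      fix c
      have "ip (\<lambda>i. x i + c * y i) (\<lambda>i. x i + c * y i) = ip x x + 2 * c * ip x y + c\<^sup>2 * ip y y" for x y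
        unfolding ip_lin ip_comm[of "\<lambda>i. x i + c * y i"] 
        by (simp add: ip_comm[of y x] algebra_simps power2_eq_square)
      then show "0 \<le> 2 * c * (s\<^sup>2 * ip w g - ip (T w) (T g)) + c\<^sup>2 * (s\<^sup>2 * ip g g - ip (T g) (T g))"
        using bound[OF perp_lin[OF w1(1) g1, of c]] w1 s by (simp add: T_lin algebra_simps)
    qed
    moreover have "s\<^sup>2 * ip w g - ip (T w) (T g) = - ip g g"
    proof -
      have "ip g g = ip g (T (T w)) - s\<^sup>2 * ip g w"
        using ip_lin[of g "T (T w)" "- s\<^sup>2" w] unfolding g_def[symmetric] by simp
      moreover have "ip g (T (T w)) = ip (T w) (T g)"
        unfolding self_adj[symmetric, of g "T w"] by (rule ip_comm)
      ultimately show ?thesis using ip_comm[of g w] by simp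
    qed
    ultimately have g0: "T (T w) i = s\<^sup>2 * w i" if "i \<in> K" for i
      using ip_zero[of g i] that by (simp add: g_def)
    have "s \<le> r"
    proof -
      define u where "u = (\<lambda>i. T w i + s * w i)"
      have u1: "ip u (\<lambda>_. 1) = 0"
        unfolding u_def by (rule perp_lin) (simp_all add: T_perp w1)
      show ?thesis
      proof (cases "\<exists>i\<in>K. u i \<noteq> 0")
        case True
        have "T u i = s * u i" if "i \<in> K" for i
          using g0[OF that] by (simp add: u_def T_lin power2_eq_square algebra_simps)
        then have "\<bar>s\<bar> \<le> r"
          using True u1 by (intro eig[of u s]) (auto simp: T_def ip_one)
        then show ?thesis by simp
      next
        case False
        then have "T w i = (- s) * w i" if "i \<in> K" for i
          using that by (auto simp: u_def)
        moreover have "\<exists>i\<in>K. w i \<noteq> 0"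
          using w1 by (auto simp: ip_def intro: ccontr)
        ultimately have "\<bar>- s\<bar> \<le> r"
          using w1 by (intro eig[of w "- s"]) (auto simp: T_def ip_one)
        then show ?thesis by simp
      qed
    qed
    have "ip (T v) (T v) \<le> s\<^sup>2 * ip v v"
      using v by (intro bound) (simp add: ip_one)
    also have "\<dots> \<le> r\<^sup>2 * ip v v"
      using s \<open>s \<le> r\<close> by (intro mult_right_mono power_mono ip_nonneg)
    finally show ?thesis by (simp add: ip_sq T_def)
  qed
qed

section \<open>Recursions with an exponentially fading memory\<close>

lemma cum_loss_mono:
  assumes "0 \<le> lam" "\<And>s. s \<le> t \<Longrightarrow> l s \<le> l' s"
  shows "cum_loss lam l t \<le> cum_loss lam l' t"
  using assms(2) by (induction t) (auto intro!: add_mono mult_left_mono assms(1))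

lemma cum_loss_scale: "cum_loss lam (\<lambda>s. c * l s) t = c * cum_loss lam l t"
  by (induction t) (auto simp: algebra_simps)

lemma cum_loss_nonneg: "0 \<le> lam \<Longrightarrow> (\<And>s. 0 \<le> l s) \<Longrightarrow> 0 \<le> cum_loss lam l t"
  by (induction t) auto

text \<open>
  The memory \<open>cum_loss lam e t\<close> is the second state of a nonnegative linear system, whose
  fixed point is \<open>F\<close> for \<open>e\<close> and \<open>F / (1 - lam)\<close> for the memory. The deviation from it is dominated by
  \<open>rho ^ t * (1, k)\<close> as soon as \<open>(1, k)\<close> is a supersolution of the homogeneous system with factor \<open>rho\<close>. Taking
  \<open>k = rho / (rho - lam)\<close> gives equality in the memory equation, and the equation for \<open>e\<close> then asks for
  \<open>a * rho \<le> (rho - r) * (rho - lam)\<close>. At \<open>rho = 1\<close> this is the assumed gap, with strict inequality, so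
  some \<open>rho < 1\<close> works.
\<close>

lemma geometric_decay_with_fading_memory:
  fixes e :: "nat \<Rightarrow> real"
  assumes e: "\<And>t. 0 \<le> e t" and lam: "0 \<le> lam" "lam < 1" and r: "0 \<le> r" and a: "0 \<le> a"
    and rec: "\<And>t. e (Suc t) \<le> r * e t + a * cum_loss lam e t + c" and c: "0 \<le> c"
    and gain: "a < (1 - r) * (1 - lam)"
  obtains rho where "0 < rho" "rho < 1"
    "\<And>t. e t \<le> rho ^ t * e 0 + c * (1 - lam) / ((1 - r) * (1 - lam) - a)"
proof -
  define gap where "gap = (1 - r) * (1 - lam) - a"
  \<comment> \<open>As \<open>r\<close> and \<open>lam\<close> are nonnegative, \<open>(rho - r) * (rho - lam)\<close> has slope at most 2 below 1, so going down by \<open>gap / 2\<close> costs at most \<open>gap\<close>.\<close>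
  define rho where "rho = 1 - gap / 2"
  define F where "F = c * (1 - lam) / gap"
  define k where "k = rho / (rho - lam)"
  have gap: "0 < gap" using gain by (simp add: gap_def)
  have "r < 1" using a gain lam by (metis diff_gt_0_iff_gt less_le_trans not_less order_less_imp_le zero_less_mult_pos2 le_less_trans)
  have "gap \<le> (1 - r) * (1 - lam)" using a by (simp add: gap_def)
  also have "\<dots> \<le> 1 * (1 - lam)" using r lam by (intro mult_right_mono) auto
  finally have gap_le: "gap \<le> 1 - lam" by simp
  have rho: "0 < rho" "rho < 1" "lam < rho" using gap gap_le lam by (auto simp: rho_def)
  have F0: "0 \<le> F" using c lam gap by (simp add: F_def)
  have F_fix: "r * F + a * (F / (1 - lam)) + c = F"
  proof -
    have "(1 - lam) * (r * F + a * (F / (1 - lam)) + c - F) = c * (1 - lam) - gap * F"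
      using lam by (simp add: gap_def field_simps)
    also have "\<dots> = 0" using gap by (simp add: F_def)
    finally show ?thesis using lam by simp
  qed
  have "a \<le> (rho - r) * (rho - lam)"
  proof -
    have "(rho - r) * (rho - lam) = (1 - r) * (1 - lam) - gap / 2 * (2 - r - lam) + (gap / 2)\<^sup>2"
      by (simp add: rho_def power2_eq_square algebra_simps)
    moreover have "gap / 2 * (2 - r - lam) \<le> gap / 2 * 2"
      using gap r lam by (intro mult_left_mono) auto
    moreover have "0 \<le> (gap / 2)\<^sup>2" by simp
    moreover have "a = (1 - r) * (1 - lam) - gap" by (simp add: gap_def)
    ultimately show ?thesis by linarith
  qed
  moreover have "rho * a \<le> a" using rho a by (simp add: mult_left_le_one_le)
  ultimately have "a * rho \<le> (rho - r) * (rho - lam)" by (simp add: mult.commute)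
  then have e_step: "r + a * k \<le> rho" using rho by (simp add: k_def field_simps)
  have S_step: "lam * k + rho = k * rho" using rho by (simp add: k_def field_simps)
  have k1: "1 \<le> k" using rho lam by (simp add: k_def field_simps)
  have "e t \<le> rho ^ t * e 0 + F \<and> cum_loss lam e t \<le> k * (rho ^ t * e 0) + F / (1 - lam)" for t
  proof (induction t)
    case 0
    have "e 0 \<le> k * e 0" using mult_right_mono[OF k1 e[of 0]] by simp
    moreover have "0 \<le> F / (1 - lam)" using F0 lam by simp
    ultimately show ?case using F0 by simp
  next
    case (Suc t)
    define y where "y = rho ^ t * e 0"
    have y: "0 \<le> y" using rho e by (simp add: y_def)
    have "e (Suc t) \<le> r * (y + F) + a * (k * y + F / (1 - lam)) + c"
      using rec[of t] Suc r a
        mult_left_mono[of "e t" "y + F" r] mult_left_mono[of "cum_loss lam e t" "k * y + F / (1 - lam)" a]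
      by (simp add: y_def)
    also have "\<dots> = (r + a * k) * y + F"
      using F_fix by (simp add: algebra_simps)
    also have "\<dots> \<le> rho * y + F"
      using e_step y by (intro add_mono mult_right_mono) auto
    finally have 1: "e (Suc t) \<le> rho * y + F" .
    have "cum_loss lam e (Suc t) \<le> lam * (k * y + F / (1 - lam)) + (rho * y + F)"
      using Suc 1 mult_left_mono[of "cum_loss lam e t" "k * y + F / (1 - lam)" lam] lam
      by (simp add: y_def)
    also have "\<dots> = (lam * k + rho) * y + F / (1 - lam)"
      using lam by (simp add: field_simps)
    finally show ?case using 1 S_step by (simp add: y_def mult_ac)
  qed
  then show ?thesis using that[of rho] rho by (simp add: F_def gap_def)
qed

section \<open>The spectrum of the normalised Laplacian\<close>

lemma L_sym_carrier: "L_sym G H \<in> carrier_mat (card H) (card H)"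
  unfolding L_sym_def hdeg_inv_sqrt_def hadj_def Let_def
  by (intro minus_carrier_mat mult_carrier_mat[of _ _ "card H"] mat_diag_dim mat_carrier)

text \<open>
  Since 0 is an eigenvalue as well, a positive eigenvalue cannot occupy the first place of the
  increasing list; so it is among those over which \<open>rho0\<close> takes its maximum.
\<close>

lemma positive_eigenvalue_is_mu:
  assumes zero: "eigenvalue (L_sym G H) 0" and nu: "eigenvalue (L_sym G H) nu" "0 < nu"
  shows "\<exists>l\<in>{2..card H}. mu G H l = nu"
proof -
  let ?p = "char_poly (L_sym G H)"
  let ?s = "sorted_list_of_multiset (proots ?p)"
  note L = L_sym_carrier[of G H]
  have deg: "degree ?p = card H" "?p \<noteq> 0"
    using degree_monic_char_poly[OF L] by auto
  have "nu \<in> set ?s" "0 \<in> set ?s"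
    using zero nu deg(2) by (simp_all add: eigenvalue_root_char_poly[OF L])
  then obtain a b where a: "a < length ?s" "?s ! a = nu" and b: "b < length ?s" "?s ! b = 0"
    by (metis in_set_conv_nth)
  have "a \<noteq> 0"
  proof
    assume "a = 0"
    then have "?s ! a \<le> ?s ! b" using b by (intro sorted_nth_mono) auto
    then show False using a b nu by simp
  qed
  moreover have "length ?s \<le> card H"
    using size_proots_le[of ?p] deg by (metis mset_sorted_list_of_multiset size_mset)
  ultimately show ?thesis
    using a by (intro bexI[of _ "Suc a"]) (auto simp: mu_def)
qed

text \<open>
  Positive honest degrees give sense to the averages over honest neighbours and to \<open>D\<^sup>-\<^sup>1\<^sup>/\<^sup>2\<close>; they also
  force at least two honest nodes, so that \<open>rho0\<close> is a maximum over a nonempty set.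
\<close>

locale honest_network =
  fixes G :: "nat pair_pre_digraph" and H :: "nat set"
  assumes graph: "pair_graph G" and H_nodes: "H \<subseteq> pverts G"
    and hdeg_pos: "\<And>i. i \<in> H \<Longrightarrow> 0 < hdeg G H i"
    and H_connected: "Digraph_Component.connected (induce_subgraph (with_proj G) H)"
begin

sublocale pair_graph G by (rule graph)

abbreviation d :: "nat \<Rightarrow> real" where "d i \<equiv> real (hdeg G H i)"

lemma hdeg_nonzero: "i \<in> H \<Longrightarrow> hdeg G H i \<noteq> 0"
  using hdeg_pos by fastforce

lemma finite_H: "finite H"
  using H_nodes pair_finite_verts by (rule finite_subset)

lemma H_nonempty: "H \<noteq> {}"
  using H_connected by (auto simp: Digraph_Component.connected_def strongly_connected_def)

lemma finite_nbrs: "finite (nbrs G i)"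
  using pair_finite_verts by (rule rev_finite_subset) (force simp: nbrs_def dest: arc_snd_in_verts)+

lemma nbrs_sym: "j \<in> nbrs G i \<longleftrightarrow> i \<in> nbrs G j"
  using pair_sym_arcs by (auto simp: nbrs_def symmetric_def sym_def)

lemma sum_honest_nbrs:
  "(\<Sum>j\<in>nbrs G i \<inter> H. f j) = (\<Sum>j\<in>H. if j \<in> nbrs G i then f j else (0::'b::comm_monoid_add))"
  using finite_H by (simp add: sum.inter_filter[symmetric] Int_def conj_commute)

lemma sum_edges_swap:
  fixes f :: "nat \<Rightarrow> nat \<Rightarrow> 'b::comm_monoid_add"
  shows "(\<Sum>i\<in>H. \<Sum>j\<in>nbrs G i \<inter> H. f i j) = (\<Sum>i\<in>H. \<Sum>j\<in>nbrs G i \<inter> H. f j i)"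
proof -
  have "(\<Sum>i\<in>H. \<Sum>j\<in>nbrs G i \<inter> H. f i j) = (\<Sum>j\<in>H. \<Sum>i\<in>H. if j \<in> nbrs G i then f i j else 0)"
    unfolding sum_honest_nbrs by (rule sum.swap)
  then show ?thesis
    by (simp add: sum_honest_nbrs nbrs_sym)
qed

lemma constant_if_equal_on_edges:
  assumes "\<And>i j. i \<in> H \<Longrightarrow> j \<in> nbrs G i \<inter> H \<Longrightarrow> u i = u j" and "i \<in> H" "j \<in> H"
  shows "u i = u j"
proof -
  let ?S = "with_proj (mk_symmetric (with_proj G \<restriction> H))"
  have "i \<rightarrow>\<^sup>*\<^bsub>?S\<^esub> j"
    using H_connected assms(2,3) by (auto simp: Digraph_Component.connected_def strongly_connected_def)
  then have "(i, j) \<in> (arcs_ends ?S)\<^sup>*"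
    by (rule reachable_rtranclI)
  then show ?thesis
  proof (induction rule: rtrancl_induct)
    case base
    show ?case ..
  next
    case (step x y)
    then have "x \<in> H" "y \<in> nbrs G x \<inter> H"
      using nbrs_sym by (auto simp: parcs_mk_symmetric nbrs_def)
    then show ?case using step assms(1) by metis
  qed
qed

text \<open>
  The assumption says that \<open>u\<close> is an eigenvector of the random walk matrix \<open>D\<^sup>-\<^sup>1 A\<close> for \<open>1 - nu\<close>, which is similar
  to \<open>I - L_sym\<close>; the corresponding eigenvector of \<open>L_sym\<close> is \<open>D\<^sup>1\<^sup>/\<^sup>2 u\<close>.
\<close>

lemma eigenvalue_L_sym:
  assumes u: "\<And>i. i \<in> H \<Longrightarrow> (\<Sum>j\<in>nbrs G i \<inter> H. u j) = (1 - nu) * (d i * u i)"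
    and nz: "\<exists>i\<in>H. u i \<noteq> 0"
  shows "eigenvalue (L_sym G H) nu"
proof -
  define h where "h = sorted_list_of_set H"
  define n where "n = card H"
  define v where "v = Matrix.vec n (\<lambda>a. sqrt (d (h ! a)) * u (h ! a))"
  have bij: "bij_betw ((!) h) {..<n} H"
    using finite_H by (intro bij_betw_nth) (auto simp: h_def n_def)
  have hH: "h ! a \<in> H" if "a < n" for a
    using bij that by (auto simp: bij_betw_def)
  have L: "L_sym G H \<in> carrier_mat n n"
    unfolding n_def by (rule L_sym_carrier)
  have entry: "L_sym G H $$ (a, b) = (if a = b then 1 else 0)
      - (if h ! b \<in> nbrs G (h ! a) then 1 / (sqrt (d (h ! a)) * sqrt (d (h ! b))) else 0)"
    if "a < n" "b < n" for a b
  proof -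
    have A: "hadj G H \<in> carrier_mat n n" by (simp add: hadj_def n_def Let_def)
    have DA: "hdeg_inv_sqrt G H * hadj G H =
        Matrix.mat n n (\<lambda>(a, b). 1 / sqrt (d (h ! a)) * hadj G H $$ (a, b))"
      unfolding hdeg_inv_sqrt_def n_def[symmetric] h_def[symmetric] by (rule mat_diag_mult_left[OF A])
    have "hdeg_inv_sqrt G H * hadj G H * hdeg_inv_sqrt G H =
        Matrix.mat n n (\<lambda>(a, b). (hdeg_inv_sqrt G H * hadj G H) $$ (a, b) * (1 / sqrt (d (h ! b))))"
      unfolding hdeg_inv_sqrt_def n_def[symmetric] h_def[symmetric]
      by (intro mat_diag_mult_right mult_carrier_mat[OF mat_diag_dim A])
    then show ?thesis
      using that by (simp add: L_sym_def n_def[symmetric] DA) (simp add: hadj_def n_def h_def nbrs_def Let_def)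
  qed
  have "L_sym G H *\<^sub>v v = nu \<cdot>\<^sub>v v"
  proof (rule eq_vecI)
    fix a assume "a < dim_vec (nu \<cdot>\<^sub>v v)"
    then have a: "a < n" by (simp add: v_def)
    define i where "i = h ! a"
    have i: "i \<in> H" using hH[OF a] by (simp add: i_def)
    have "(L_sym G H *\<^sub>v v) $ a = (\<Sum>b<n. L_sym G H $$ (a, b) * (sqrt (d (h ! b)) * u (h ! b)))"
      using L a by (simp add: mult_mat_vec_def scalar_prod_def v_def atLeast0LessThan)
    also have "\<dots> = (\<Sum>b<n. (if a = b then sqrt (d (h ! b)) * u (h ! b) else 0)
        - (if h ! b \<in> nbrs G i then u (h ! b) else 0) / sqrt (d i))"
    proof (intro sum.cong refl)
      fix b assume "b \<in> {..<n}"
      then have b: "b < n" by simp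
      have "sqrt (d (h ! a)) \<noteq> 0" "sqrt (d (h ! b)) \<noteq> 0"
        using hdeg_nonzero[OF hH[OF a]] hdeg_nonzero[OF hH[OF b]] by auto
      then show "L_sym G H $$ (a, b) * (sqrt (d (h ! b)) * u (h ! b)) =
          (if a = b then sqrt (d (h ! b)) * u (h ! b) else 0)
          - (if h ! b \<in> nbrs G i then u (h ! b) else 0) / sqrt (d i)"
        unfolding entry[OF a b] i_def by (simp add: divide_simps left_diff_distrib)
    qed
    also have "\<dots> = sqrt (d i) * u i - (\<Sum>b<n. if h ! b \<in> nbrs G i then u (h ! b) else 0) / sqrt (d i)"
      using a by (simp add: sum_subtractf sum_divide_distrib i_def)
    also have "(\<Sum>b<n. if h ! b \<in> nbrs G i then u (h ! b) else 0) = (\<Sum>j\<in>nbrs G i \<inter> H. u j)"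
      unfolding sum_honest_nbrs by (rule sum.reindex_bij_betw[OF bij])
    also have "sqrt (d i) * u i - \<dots> / sqrt (d i) = nu * (sqrt (d i) * u i)"
    proof -
      have "d i = sqrt (d i) * sqrt (d i)" by simp
      then have "(1 - nu) * (d i * u i) / sqrt (d i) = (1 - nu) * (sqrt (d i) * u i)"
        using hdeg_pos[OF i] by (simp add: field_simps)
      then show ?thesis by (simp add: u[OF i] algebra_simps)
    qed
    finally show "(L_sym G H *\<^sub>v v) $ a = (nu \<cdot>\<^sub>v v) $ a"
      using a by (simp add: v_def i_def)
  qed (use L in \<open>simp add: v_def\<close>)
  moreover have "v \<noteq> 0\<^sub>v n"
  proof
    assume "v = 0\<^sub>v n"
    then have v0: "v $ a = 0" if "a < n" for a using that by simp
    have "u (h ! a) = 0" if "a < n" for a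
      using v0[OF that] that hdeg_nonzero[OF hH[OF that]] by (simp add: v_def)
    then show False using nz bij by (auto simp: bij_betw_def)
  qed
  moreover have "v \<in> carrier_vec n" by (simp add: v_def)
  ultimately show ?thesis
    using L unfolding eigenvalue_def eigenvector_def by auto
qed

text \<open>
  The quadratic form of the Laplacian is a sum over edges; this makes eigenvalues nonnegative and
  forces the eigenvectors for \<open>nu = 0\<close> to be constant along edges.
\<close>

lemma dirichlet_form:
  assumes u: "\<And>i. i \<in> H \<Longrightarrow> (\<Sum>j\<in>nbrs G i \<inter> H. u j) = (1 - nu) * (d i * u i)"
  shows "(\<Sum>i\<in>H. \<Sum>j\<in>nbrs G i \<inter> H. (u i - u j)\<^sup>2) = 2 * nu * (\<Sum>i\<in>H. d i * (u i)\<^sup>2)"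
proof -
  have sq: "(\<Sum>i\<in>H. \<Sum>j\<in>nbrs G i \<inter> H. (u i)\<^sup>2) = (\<Sum>i\<in>H. d i * (u i)\<^sup>2)"
    by (simp add: hdeg_def)
  have "(\<Sum>i\<in>H. \<Sum>j\<in>nbrs G i \<inter> H. u i * u j) = (\<Sum>i\<in>H. u i * (\<Sum>j\<in>nbrs G i \<inter> H. u j))"
    by (simp add: sum_distrib_left)
  also have "\<dots> = (1 - nu) * (\<Sum>i\<in>H. d i * (u i)\<^sup>2)"
    by (simp add: u sum_distrib_left power2_eq_square mult_ac)
  finally have cross: "(\<Sum>i\<in>H. \<Sum>j\<in>nbrs G i \<inter> H. u i * u j) = (1 - nu) * (\<Sum>i\<in>H. d i * (u i)\<^sup>2)" .
  have "(\<Sum>i\<in>H. \<Sum>j\<in>nbrs G i \<inter> H. (u i - u j)\<^sup>2) =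
      (\<Sum>i\<in>H. \<Sum>j\<in>nbrs G i \<inter> H. (u i)\<^sup>2) + (\<Sum>i\<in>H. \<Sum>j\<in>nbrs G i \<inter> H. (u j)\<^sup>2)
      - 2 * (\<Sum>i\<in>H. \<Sum>j\<in>nbrs G i \<inter> H. u i * u j)"
    by (simp add: power2_diff sum.distrib sum_subtractf sum_distrib_left mult.assoc)
  also have "(\<Sum>i\<in>H. \<Sum>j\<in>nbrs G i \<inter> H. (u j)\<^sup>2) = (\<Sum>i\<in>H. \<Sum>j\<in>nbrs G i \<inter> H. (u i)\<^sup>2)"
    by (rule sum_edges_swap)
  finally show ?thesis
    by (simp only: sq cross) (simp add: algebra_simps)
qed

text \<open>
  Connectivity enters here: an eigenvector for \<open>nu = 0\<close> would be constant, and a nonzero constant is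
  not orthogonal to the constants. So \<open>nu > 0\<close>, and \<open>nu\<close> is one of the \<open>mu l\<close> with \<open>l \<ge> 2\<close>.
\<close>

lemma eigenvalue_le_rho0:
  assumes u: "\<And>i. i \<in> H \<Longrightarrow> (\<Sum>j\<in>nbrs G i \<inter> H. u j) = (1 - nu) * (d i * u i)"
    and nz: "\<exists>i\<in>H. u i \<noteq> 0" and perp: "(\<Sum>i\<in>H. d i * u i) = 0"
  shows "\<bar>1 - alpha * nu\<bar> \<le> rho0 G H alpha"
proof -
  have energy: "0 < (\<Sum>i\<in>H. d i * (u i)\<^sup>2)"
    using nz finite_H hdeg_pos by (auto intro!: sum_pos2)
  have edges: "0 \<le> (\<Sum>i\<in>H. \<Sum>j\<in>nbrs G i \<inter> H. (u i - u j)\<^sup>2)"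
    by (intro sum_nonneg) simp
  have "nu \<noteq> 0"
  proof
    assume "nu = 0"
    then have "(\<Sum>i\<in>H. \<Sum>j\<in>nbrs G i \<inter> H. (u i - u j)\<^sup>2) = 0"
      using dirichlet_form[OF u] by simp
    then have "u i = u j" if "i \<in> H" "j \<in> nbrs G i \<inter> H" for i j
      using that finite_H by (simp add: sum_nonneg_eq_0_iff sum_nonneg)
    then have const: "u i = u j" if "i \<in> H" "j \<in> H" for i j
      using constant_if_equal_on_edges[of u, OF _ that] by blast
    obtain k where k: "k \<in> H" "u k \<noteq> 0" using nz by blast
    have "(\<Sum>i\<in>H. d i * u i) = (\<Sum>i\<in>H. d i) * u k"
      using const[OF _ k(1)] by (simp add: sum_distrib_right)
    moreover have "0 < (\<Sum>i\<in>H. d i)"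
      using finite_H H_nonempty hdeg_pos by (intro sum_pos) auto
    ultimately show False using perp k by simp
  qed
  moreover have "0 \<le> nu"
  proof -
    have "0 \<le> nu * (\<Sum>i\<in>H. d i * (u i)\<^sup>2)" using edges dirichlet_form[OF u] by simp
    then show ?thesis using energy by (simp add: zero_le_mult_iff)
  qed
  ultimately have "0 < nu" by simp
  moreover have "eigenvalue (L_sym G H) nu"
    using u nz by (rule eigenvalue_L_sym)
  moreover have "eigenvalue (L_sym G H) 0"
    using H_nonempty by (intro eigenvalue_L_sym[of "\<lambda>_. 1"]) (auto simp: hdeg_def)
  ultimately obtain l where "l \<in> {2..card H}" "mu G H l = nu"
    using positive_eigenvalue_is_mu by blast
  then show ?thesis
    unfolding rho0_def by (intro Max_ge) auto
qed

lemma scalar_averaging_contracts: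
  assumes alpha: "0 < alpha" and v: "(\<Sum>i\<in>H. d i * v i) = 0"
  shows "(\<Sum>i\<in>H. d i * ((1 - alpha) * v i + alpha / d i * (\<Sum>j\<in>nbrs G i \<inter> H. v j))\<^sup>2)
      \<le> (rho0 G H alpha)\<^sup>2 * (\<Sum>i\<in>H. d i * (v i)\<^sup>2)"
proof -
  define a where "a i j = (if i = j then 1 - alpha else 0) + (if j \<in> nbrs G i then alpha / d i else 0)" for i j
  have a_sum: "(\<Sum>j\<in>H. a i j * w j) = (1 - alpha) * w i + alpha / d i * (\<Sum>j\<in>nbrs G i \<inter> H. w j)"
    if "i \<in> H" for i w
  proof -
    have "(\<Sum>j\<in>H. a i j * w j) = (\<Sum>j\<in>H. (if i = j then (1 - alpha) * w j else 0)
        + alpha / d i * (if j \<in> nbrs G i then w j else 0))"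
      by (intro sum.cong) (auto simp: a_def algebra_simps)
    then show ?thesis
      using that finite_H by (simp add: sum.distrib sum_honest_nbrs flip: sum_distrib_left sum_divide_distrib)
  qed
  have "(\<Sum>i\<in>H. d i * (\<Sum>j\<in>H. a i j * v j)\<^sup>2) \<le> (rho0 G H alpha)\<^sup>2 * (\<Sum>i\<in>H. d i * (v i)\<^sup>2)"
  proof (rule contraction_if_eigenvalues_bounded[OF finite_H])
    show "d i * a i j = d j * a j i" if "i \<in> H" "j \<in> H" for i j
      using that hdeg_pos[OF that(1)] hdeg_pos[OF that(2)] nbrs_sym by (auto simp: a_def)
    show "(\<Sum>j\<in>H. a i j) = 1" if "i \<in> H" for i
      using a_sum[OF that, of "\<lambda>_. 1"] hdeg_pos[OF that] by (simp add: hdeg_def)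
    show "\<bar>th\<bar> \<le> rho0 G H alpha"
      if eig: "\<And>i. i \<in> H \<Longrightarrow> (\<Sum>j\<in>H. a i j * u j) = th * u i"
        and "(\<Sum>i\<in>H. d i * u i) = 0" "\<exists>i\<in>H. u i \<noteq> 0" for th u
    proof -
      define nu where "nu = (1 - th) / alpha"
      have "(\<Sum>j\<in>nbrs G i \<inter> H. u j) = (1 - nu) * (d i * u i)" if "i \<in> H" for i
      proof -
        have "alpha / d i * (\<Sum>j\<in>nbrs G i \<inter> H. u j) = (th - 1 + alpha) * u i"
          using eig[OF that] a_sum[OF that, of u] by (simp add: algebra_simps)
        then show ?thesis
          using alpha hdeg_pos[OF that] by (simp add: nu_def field_simps)
      qed
      then have "\<bar>1 - alpha * nu\<bar> \<le> rho0 G H alpha"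
        using that by (intro eigenvalue_le_rho0) auto
      then show ?thesis using alpha by (simp add: nu_def)
    qed
  qed (use hdeg_pos v in auto)
  then show ?thesis by (simp add: a_sum)
qed

section \<open>Disagreement and averaging\<close>

lemma norm_D_sq: "(norm_D G H Z)\<^sup>2 = (\<Sum>i\<in>H. d i * (norm (Z i))\<^sup>2)"
  by (simp add: norm_D_def L2_set_def sum_nonneg power_mult_distrib)

lemma norm_D_nonneg: "0 \<le> norm_D G H Z"
  by (simp add: norm_D_def)

lemma norm_D_cong: "(\<And>i. i \<in> H \<Longrightarrow> Z i = Y i) \<Longrightarrow> norm_D G H Z = norm_D G H Y"
  unfolding norm_D_def by (intro L2_set_cong) auto

lemma norm_D_triangle: "norm_D G H (\<lambda>i. Z i + Y i) \<le> norm_D G H Z + norm_D G H Y"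
proof -
  have "norm_D G H (\<lambda>i. Z i + Y i) \<le>
      L2_set (\<lambda>i. norm (sqrt (d i) *\<^sub>R Z i) + norm (sqrt (d i) *\<^sub>R Y i)) H"
    unfolding norm_D_def scaleR_add_right by (intro L2_set_mono norm_triangle_ineq) auto
  also have "\<dots> \<le> norm_D G H Z + norm_D G H Y"
    unfolding norm_D_def by (rule L2_set_triangle_ineq)
  finally show ?thesis .
qed

lemma norm_D_scale: "0 \<le> c \<Longrightarrow> norm_D G H (\<lambda>i. c *\<^sub>R Z i) = c * norm_D G H Z"
  unfolding norm_D_def by (simp add: L2_set_right_distrib mult_ac)

definition average :: "(nat \<Rightarrow> real ^ 'd) \<Rightarrow> nat \<Rightarrow> real ^ 'd" where
  "average X i = (1 / d i) *\<^sub>R (\<Sum>j\<in>nbrs G i \<inter> H. X j)"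

text \<open>
  The consensus value \<open>(\<pi>\<^sup>T \<otimes> I) X\<close> to which the disagreement refers.
\<close>

definition centre :: "(nat \<Rightarrow> real ^ 'd) \<Rightarrow> real ^ 'd" where
  "centre X = (\<Sum>l\<in>H. pi_vec G H l *\<^sub>R X l)"

lemma sum_d_pos: "0 < (\<Sum>l\<in>H. d l)"
  using finite_H H_nonempty hdeg_pos by (intro sum_pos) auto

lemma scaled_centre: "(\<Sum>l\<in>H. d l) *\<^sub>R centre X = (\<Sum>l\<in>H. d l *\<^sub>R X l)"
proof -
  have "(\<Sum>l\<in>H. d l) * (d i / (\<Sum>l\<in>H. d l)) = d i" for i
    using sum_d_pos by simp
  then show ?thesis
    by (simp only: centre_def pi_vec_def scaleR_sum_right scaleR_scaleR)
qed

lemma centre_eqI: "(\<Sum>l\<in>H. d l *\<^sub>R X l) = (\<Sum>l\<in>H. d l *\<^sub>R Y l) \<Longrightarrow> centre X = centre Y"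
  using sum_d_pos scaled_centre[of X] scaled_centre[of Y] by (metis less_irrefl scaleR_cancel_left)

lemma disagreement_eq: "i \<in> H \<Longrightarrow> disagreement G H X i = X i - centre X"
  using finite_H
  by (simp add: disagreement_def centre_def scaleR_left_diff_distrib sum_subtractf if_distrib[of "\<lambda>c. c *\<^sub>R _"] cong: if_cong)

lemma disagreement_centred: "(\<Sum>i\<in>H. d i *\<^sub>R disagreement G H X i) = 0"
  using scaled_centre[of X]
  by (simp add: disagreement_eq scaleR_right_diff_distrib sum_subtractf scaleR_sum_left)

text \<open>
  The weights \<open>\<pi>\<close> are the stationary distribution of the random walk on the honest subgraph.
\<close>

lemma centre_average: "centre (average X) = centre X"
proof (rule centre_eqI)
  have "(\<Sum>l\<in>H. d l *\<^sub>R average X l) = (\<Sum>l\<in>H. \<Sum>j\<in>nbrs G l \<inter> H. X j)"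
    by (intro sum.cong) (simp_all add: average_def hdeg_nonzero)
  also have "\<dots> = (\<Sum>l\<in>H. \<Sum>j\<in>nbrs G l \<inter> H. X l)" by (rule sum_edges_swap)
  finally show "(\<Sum>l\<in>H. d l *\<^sub>R average X l) = (\<Sum>l\<in>H. d l *\<^sub>R X l)"
    by (simp add: hdeg_def sum_constant_scaleR del: sum_constant)
qed

lemma disagreement_average:
  assumes "i \<in> H"
  shows "average (disagreement G H X) i = average X i - centre X"
proof -
  have "(\<Sum>j\<in>nbrs G i \<inter> H. disagreement G H X j) = (\<Sum>j\<in>nbrs G i \<inter> H. X j) - d i *\<^sub>R centre X"
    by (simp add: disagreement_eq sum_subtractf hdeg_def sum_constant_scaleR del: sum_constant)
  then show ?thesis
    using hdeg_pos[OF assms] by (simp add: average_def scaleR_right_diff_distrib)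
qed

lemma averaging_contracts:
  assumes alpha: "0 < alpha" and rho0: "0 \<le> rho0 G H alpha" and Z: "(\<Sum>i\<in>H. d i *\<^sub>R Z i) = 0"
  shows "norm_D G H (\<lambda>i. (1 - alpha) *\<^sub>R Z i + alpha *\<^sub>R average Z i) \<le> rho0 G H alpha * norm_D G H Z"
proof (rule power2_le_imp_le)
  have coord: "(\<Sum>i\<in>H. d i * (norm (Y i))\<^sup>2) = (\<Sum>k\<in>UNIV. \<Sum>i\<in>H. d i * (Y i $ k)\<^sup>2)"
    for Y :: "nat \<Rightarrow> real ^ 'd"
    unfolding power2_norm_eq_inner inner_vec_def sum_distrib_left
    by (subst sum.swap) (simp add: power2_eq_square)
  have "(\<Sum>i\<in>H. d i * (((1 - alpha) *\<^sub>R Z i + alpha *\<^sub>R average Z i) $ k)\<^sup>2)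
      \<le> (rho0 G H alpha)\<^sup>2 * (\<Sum>i\<in>H. d i * (Z i $ k)\<^sup>2)" for k
  proof -
    have "(\<Sum>i\<in>H. d i * Z i $ k) = 0"
      using arg_cong[OF Z, of "\<lambda>w. w $ k"] by (simp add: sum_component)
    from scalar_averaging_contracts[OF alpha this] show ?thesis
      by (simp add: average_def sum_component)
  qed
  then show "(norm_D G H (\<lambda>i. (1 - alpha) *\<^sub>R Z i + alpha *\<^sub>R average Z i))\<^sup>2
      \<le> (rho0 G H alpha * norm_D G H Z)\<^sup>2"
    unfolding power_mult_distrib norm_D_sq coord sum_distrib_left[of _ _ UNIV] by (intro sum_mono)
qed (simp add: rho0 norm_D_nonneg)

text \<open>
  Passing to the disagreement is the orthogonal projection, for the weighted inner product, onto
  the complement of the consensus states.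
\<close>

lemma norm_D_disagreement_le: "norm_D G H (disagreement G H X) \<le> norm_D G H X"
proof (rule power2_le_imp_le)
  let ?c = "centre X" and ?E = "disagreement G H X"
  have "(norm_D G H X)\<^sup>2 = (\<Sum>i\<in>H. d i * (norm (?E i + ?c))\<^sup>2)"
    by (simp add: norm_D_sq disagreement_eq)
  also have "\<dots> = (\<Sum>i\<in>H. d i * (norm (?E i))\<^sup>2 + 2 * inner (d i *\<^sub>R ?E i) ?c + d i * (norm ?c)\<^sup>2)"
    by (intro sum.cong refl) (simp add: power2_norm_eq_inner inner_add_left inner_add_right inner_commute algebra_simps)
  also have "\<dots> = (norm_D G H ?E)\<^sup>2 + 2 * inner (\<Sum>i\<in>H. d i *\<^sub>R ?E i) ?c + (\<Sum>i\<in>H. d i * (norm ?c)\<^sup>2)"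
    by (simp add: norm_D_sq sum.distrib sum_distrib_left inner_sum_left)
  also have "\<dots> = (norm_D G H ?E)\<^sup>2 + (\<Sum>i\<in>H. d i * (norm ?c)\<^sup>2)"
    by (simp add: disagreement_centred)
  finally show "(norm_D G H ?E)\<^sup>2 \<le> (norm_D G H X)\<^sup>2"
    by (simp add: sum_nonneg)
qed (rule norm_D_nonneg)

lemma hdeg_min_le: "i \<in> H \<Longrightarrow> hdeg_min G H \<le> hdeg G H i"
  unfolding hdeg_min_def using finite_H by (intro Min_le) auto

lemma hdeg_max_ge: "i \<in> H \<Longrightarrow> hdeg G H i \<le> hdeg_max G H"
  unfolding hdeg_max_def using finite_H by (intro Max_ge) auto

lemma hdeg_min_pos: "0 < hdeg_min G H"
  unfolding hdeg_min_def using finite_H H_nonempty hdeg_pos by (subst Min_gr_iff) auto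

text \<open>
  For \<open>i \<noteq> j\<close> the squares of both disagreements are separate terms of the squared \<open>norm_D\<close>, so
  \<open>(a + b)\<^sup>2 \<le> 2 (a\<^sup>2 + b\<^sup>2)\<close> gives the factor \<open>sqrt 2\<close>.
\<close>

lemma norm_diff_le_disagreement:
  assumes "i \<in> H" "j \<in> H"
  shows "norm (X i - X j) \<le> sqrt (2 / real (hdeg_min G H)) * norm_D G H (disagreement G H X)"
proof (cases "i = j")
  case True
  then show ?thesis by (simp add: norm_D_nonneg)
next
  case False
  let ?E = "disagreement G H X" and ?m = "real (hdeg_min G H)"
  have m: "0 < ?m" using hdeg_min_pos by simp
  have "(norm (X i - X j))\<^sup>2 = (norm (?E i - ?E j))\<^sup>2"
    using assms by (simp add: disagreement_eq)
  also have "\<dots> \<le> (norm (?E i) + norm (?E j))\<^sup>2"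
    by (intro power_mono norm_triangle_ineq4) simp
  also have "\<dots> \<le> 2 * ((norm (?E i))\<^sup>2 + (norm (?E j))\<^sup>2)"
    using sum_squares_bound[of "norm (?E i)" "norm (?E j)"] by (simp add: power2_sum)
  also have "\<dots> = 2 / ?m * (?m * (norm (?E i))\<^sup>2 + ?m * (norm (?E j))\<^sup>2)"
    using m by (simp add: field_simps)
  also have "\<dots> \<le> 2 / ?m * (d i * (norm (?E i))\<^sup>2 + d j * (norm (?E j))\<^sup>2)"
    using m hdeg_min_le assms by (intro mult_left_mono add_mono mult_right_mono) auto
  also have "\<dots> = 2 / ?m * (\<Sum>l\<in>{i, j}. d l * (norm (?E l))\<^sup>2)"
    using False by simp
  also have "\<dots> \<le> 2 / ?m * (norm_D G H ?E)\<^sup>2"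
    unfolding norm_D_sq using m assms finite_H by (intro mult_left_mono sum_mono2) auto
  also have "\<dots> = (sqrt (2 / ?m) * norm_D G H ?E)\<^sup>2"
    using m by (simp add: power_mult_distrib)
  finally show ?thesis
    by (rule power2_le_imp_le) (use m in \<open>simp add: norm_D_nonneg\<close>)
qed

lemma rho0_nonneg: "0 \<le> rho0 G H alpha"
proof -
  obtain i where i: "i \<in> H" using H_nonempty by blast
  then have "nbrs G i \<inter> H \<noteq> {}" using hdeg_pos by (fastforce simp: hdeg_def)
  then obtain j where j: "j \<in> nbrs G i" "j \<in> H" by blast
  then have "i \<noteq> j" using pair_no_loops by (force simp: nbrs_def)
  then have "card {i, j} \<le> card H" using i j finite_H by (intro card_mono) auto
  then have "2 \<le> card H" using \<open>i \<noteq> j\<close> by simp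
  then have "\<bar>1 - alpha * mu G H 2\<bar> \<le> rho0 G H alpha"
    unfolding rho0_def by (intro Max_ge) auto
  then show ?thesis by linarith
qed

end

section \<open>Runs with Byzantine senders\<close>

text \<open>
  The single bound \<open>M\<close> serves for the initial honest states and for all Byzantine messages. An update is a
  convex combination of the own state and the received messages, so \<open>M\<close> then bounds every message at every time.
\<close>

locale byzantine_run = honest_network +
  fixes B :: "nat set" and alpha eta lam M :: real
    and x :: "nat \<Rightarrow> nat \<Rightarrow> real ^ 'd" and msg :: "nat \<Rightarrow> nat \<Rightarrow> nat \<Rightarrow> real ^ 'd"
  assumes nodes: "H \<union> B = pverts G" "H \<inter> B = {}"
    and run: "A_RepC G H alpha eta lam x msg"
    and majority: "\<And>i. i \<in> H \<Longrightarrow> card (nbrs G i \<inter> B) < card (nbrs G i \<inter> H)"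
    and parameters: "0 < alpha" "alpha < 1" "0 \<le> eta" "0 \<le> lam"
    and initial_bound: "\<And>i. i \<in> H \<Longrightarrow> norm (x 0 i) \<le> M"
    and byzantine_bound: "\<And>t i j. i \<in> H \<Longrightarrow> j \<in> nbrs G i \<inter> B \<Longrightarrow> norm (msg t j i) \<le> M"
begin

lemma M_nonneg: "0 \<le> M"
  using H_nonempty initial_bound norm_ge_zero order_trans by blast

lemma nbrs_split: "nbrs G i = (nbrs G i \<inter> H) \<union> (nbrs G i \<inter> B)"
proof -
  have "nbrs G i \<subseteq> pverts G" by (force simp: nbrs_def dest: arc_snd_in_verts)
  then show ?thesis using nodes by blast
qed

lemma honest_msg: "i \<in> H \<Longrightarrow> j \<in> nbrs G i \<inter> H \<Longrightarrow> msg t j i = x t j"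
  using run by (auto simp: A_RepC_def)

lemma state_update:
  "i \<in> H \<Longrightarrow> x (Suc t) i =
    (1 - alpha) *\<^sub>R x t i + alpha *\<^sub>R (\<Sum>j\<in>nbrs G i. weight G eta lam msg t i j *\<^sub>R msg t j i)"
  using run by (auto simp: A_RepC_def)

lemma honest_nbrs_nonempty: "i \<in> H \<Longrightarrow> nbrs G i \<inter> H \<noteq> {}"
  using hdeg_pos by (fastforce simp: hdeg_def)

lemma weight_in_simplex: "i \<in> H \<Longrightarrow> weight G eta lam msg t i \<in> prob_simplex (nbrs G i)"
  unfolding weight_def using finite_nbrs honest_nbrs_nonempty by (intro sparsemax_in_prob_simplex) auto

lemma states_bounded: "i \<in> H \<Longrightarrow> norm (x t i) \<le> M"
proof (induction t arbitrary: i)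
  case 0
  then show ?case by (rule initial_bound)
next
  case (Suc t)
  let ?w = "weight G eta lam msg t i"
  have msg: "norm (msg t j i) \<le> M" if "j \<in> nbrs G i" for j
    using that Suc honest_msg byzantine_bound nbrs_split[of i] by (metis Int_iff Un_iff)
  have w: "\<And>j. j \<in> nbrs G i \<Longrightarrow> 0 \<le> ?w j" "(\<Sum>j\<in>nbrs G i. ?w j) = 1"
    using weight_in_simplex[OF Suc.prems] by (auto simp: prob_simplex_def)
  have "norm (\<Sum>j\<in>nbrs G i. ?w j *\<^sub>R msg t j i) \<le> (\<Sum>j\<in>nbrs G i. ?w j * M)"
    by (rule sum_norm_le) (simp add: w msg mult_left_mono)
  also have "\<dots> = M" by (simp add: w sum_distrib_right[symmetric])
  finally have agg: "norm (\<Sum>j\<in>nbrs G i. ?w j *\<^sub>R msg t j i) \<le> M" .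
  have "norm (x (Suc t) i) \<le> (1 - alpha) * norm (x t i) + alpha * norm (\<Sum>j\<in>nbrs G i. ?w j *\<^sub>R msg t j i)"
    unfolding state_update[OF Suc.prems] using parameters by (intro norm_triangle_le) simp
  also have "\<dots> \<le> (1 - alpha) * M + alpha * M"
    using Suc agg parameters by (intro add_mono mult_left_mono) auto
  finally show ?case by (simp add: algebra_simps)
qed

lemma msg_bounded: "i \<in> H \<Longrightarrow> j \<in> nbrs G i \<Longrightarrow> norm (msg t j i) \<le> M"
  using states_bounded honest_msg byzantine_bound nbrs_split[of i] by (metis Int_iff Un_iff)

definition err :: "nat \<Rightarrow> real" where
  "err t = norm_D G H (disagreement G H (x t))"

text \<open>
  In each coordinate the values of all honest neighbours lie within \<open>R\<close> of that of \<open>j\<close>, and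
  they are the majority; so the median lies within \<open>R\<close> of it, whatever the Byzantine senders do.
  Hence honest losses are controlled by the current disagreement.
\<close>

lemma honest_loss_le:
  assumes i: "i \<in> H" and j: "j \<in> nbrs G i \<inter> H"
  shows "loss G msg i j t \<le> sqrt (2 / real (hdeg_min G H)) * err t"
proof -
  define R where "R = sqrt (2 / real (hdeg_min G H)) * err t"
  have "\<bar>(x t j - cw_median G msg t i) $ k\<bar> \<le> R" for k
  proof -
    let ?S = "image_mset (\<lambda>l. msg t l i $ k) (mset_set (nbrs G i))"
    let ?out = "\<lambda>v. \<not> (x t j $ k - R \<le> v \<and> v \<le> x t j $ k + R)"
    have near: "\<not> ?out (msg t l i $ k)" if "l \<in> nbrs G i \<inter> H" for l
    proof -
      have "\<bar>(x t l - x t j) $ k\<bar> \<le> norm (x t l - x t j)"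
        by (rule component_le_norm_cart)
      also have "\<dots> \<le> R"
        unfolding R_def err_def using that j by (intro norm_diff_le_disagreement) auto
      finally show ?thesis by (simp add: honest_msg[OF i that] abs_le_iff)
    qed
    have "size (filter_mset ?out ?S) = card {l \<in> nbrs G i. ?out (msg t l i $ k)}"
      using finite_nbrs by (simp add: filter_mset_image_mset)
    also have "\<dots> \<le> card (nbrs G i \<inter> B)"
    proof (rule card_mono)
      show "{l \<in> nbrs G i. ?out (msg t l i $ k)} \<subseteq> nbrs G i \<inter> B"
        using near nbrs_split[of i] by blast
    qed (simp add: finite_nbrs)
    finally have out: "size (filter_mset ?out ?S) \<le> card (nbrs G i \<inter> B)" .
    have "card (nbrs G i) = card (nbrs G i \<inter> H) + card (nbrs G i \<inter> B)"
      using nbrs_split[of i] nodes(2) finite_nbrs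
      by (metis card_Un_disjoint finite_Int inf_assoc inf_bot_right inf_left_commute)
    then have "2 * size (filter_mset ?out ?S) < size ?S"
      using out majority[OF i] by simp
    from median_bounds_if_majority[OF this] show ?thesis
      by (simp add: cw_median_def abs_le_iff)
  qed
  then have "infnorm (x t j - cw_median G msg t i) \<le> R"
    unfolding infnorm_def by (intro cSup_least) (auto simp: Basis_vec_def inner_axis)
  then show ?thesis
    by (simp add: loss_def honest_msg[OF i j] R_def)
qed

definition perturbation :: "nat \<Rightarrow> nat \<Rightarrow> real ^ 'd" where
  "perturbation t i =
    (\<Sum>j\<in>nbrs G i. weight G eta lam msg t i j *\<^sub>R msg t j i) - average (x t) i"

lemma norm_perturbation_le:
  assumes i: "i \<in> H"
  shows "norm (perturbation t i) \<le> M * sqrt (card (nbrs G i)) *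
    (eta * (sqrt (d i) * (sqrt (2 / real (hdeg_min G H)) * cum_loss lam err t))
      + sqrt (card (nbrs G i \<inter> B)) / d i)"
proof -
  let ?A = "nbrs G i \<inter> H" and ?B = "nbrs G i \<inter> B"
  let ?L = "\<lambda>j. cum_loss lam (loss G msg i j) t"
  let ?c = "sqrt (2 / real (hdeg_min G H)) * cum_loss lam err t"
  have L0: "0 \<le> ?L j" for j
    using parameters by (intro cum_loss_nonneg) (simp_all add: loss_def infnorm_pos_le)
  have "average (x t) i = (1 / card ?A) *\<^sub>R (\<Sum>j\<in>?A. msg t j i)"
    by (simp add: average_def hdeg_def honest_msg[OF i])
  then have "norm (perturbation t i) \<le> M * sqrt (card (?A \<union> ?B)) * (eta * L2_set ?L ?A + sqrt (card ?B) / card ?A)"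
    using sparsemax_average_error[of ?A ?B ?L eta "\<lambda>j. msg t j i" M]
      finite_nbrs nodes honest_nbrs_nonempty[OF i] L0 parameters msg_bounded[OF i] M_nonneg
    unfolding perturbation_def weight_def nbrs_split[of i, symmetric] by auto
  also have "\<dots> \<le> M * sqrt (card (nbrs G i)) * (eta * (sqrt (d i) * ?c) + sqrt (card ?B) / d i)"
  proof -
    have "?L j \<le> ?c" if "j \<in> ?A" for j
      unfolding cum_loss_scale[symmetric] using parameters honest_loss_le[OF i that]
      by (intro cum_loss_mono) auto
    then have "L2_set ?L ?A \<le> L2_set (\<lambda>_. ?c) ?A"
      using L0 by (intro L2_set_mono) auto
    also have "\<dots> = sqrt (d i) * ?c"
    proof -
      have "0 \<le> ?c"
        using parameters by (intro mult_nonneg_nonneg cum_loss_nonneg) (auto simp: err_def norm_D_nonneg)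
      then show ?thesis by (simp add: L2_set_constant hdeg_def finite_nbrs)
    qed
    finally show ?thesis
      using M_nonneg parameters
      by (intro mult_mono add_mono mult_left_mono) (auto simp: hdeg_def nbrs_split[of i, symmetric])
  qed
  finally show ?thesis .
qed

lemma m_BH_eq: "m_BH G H B = (\<Sum>i\<in>H. card (nbrs G i \<inter> B))"
proof -
  have "{(j, i). i \<in> H \<and> j \<in> nbrs G i \<inter> B} = (\<lambda>(i, j). (j, i)) ` (SIGMA i:H. nbrs G i \<inter> B)"
    by auto
  then have "m_BH G H B = card (SIGMA i:H. nbrs G i \<inter> B)"
    unfolding m_BH_def by (simp add: card_image inj_on_def split_def)
  then show ?thesis using finite_H finite_nbrs by simp
qed

text \<open>
  The squared pointwise bounds are summed with the weights \<open>d i\<close>. The part that is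
  proportional to the memory produces \<open>C1\<close> and the part due to Byzantine weight produces \<open>C2\<close>, through
  \<open>hdeg_min \<le> d i \<le> min hdeg_max n_Xi\<close> and the fact that no node has more than \<open>m_BH\<close> Byzantine neighbours.
\<close>

lemma norm_D_perturbation_le:
  "norm_D G H (perturbation t) \<le> eta * C1 G H B M * cum_loss lam err t + C2 G H B * M"
proof -
  define S where "S = cum_loss lam err t"
  define N where "N i = real (card (nbrs G i))" for i
  define b where "b i = real (card (nbrs G i \<inter> B))" for i
  let ?m = "real (hdeg_min G H)" and ?D = "real (hdeg_max G H)" and ?n = "real (n_Xi G H B)"
    and ?mB = "real (m_BH G H B)"
  define f where "f i = M * (sqrt (N i) * (d i * sqrt (2 / ?m)))" for i
  define g where "g i = sqrt (N i) * sqrt (b i / d i)" for i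
  have S0: "0 \<le> S" using parameters by (auto simp: S_def err_def norm_D_nonneg intro!: cum_loss_nonneg)
  have m: "0 < ?m" using hdeg_min_pos by simp
  have dm: "?m \<le> d i" "d i \<le> ?D" "d i \<le> ?n" "1 \<le> ?n" "0 < d i" if "i \<in> H" for i
  proof -
    show "?m \<le> d i" "d i \<le> ?D" using hdeg_min_le hdeg_max_ge that by auto
    have "hdeg G H i \<le> card H" unfolding hdeg_def using finite_H by (intro card_mono) auto
    then show "d i \<le> ?n" by (simp add: n_Xi_def)
    show "0 < d i" using hdeg_pos that by simp
    moreover have "1 \<le> d i" using hdeg_pos[OF that] by simp
    ultimately show "1 \<le> ?n" using \<open>d i \<le> ?n\<close> by linarith
  qed
  have "norm_D G H (perturbation t) \<le> L2_set (\<lambda>i. eta * S * f i + M * g i) H"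
    unfolding norm_D_def
  proof (rule L2_set_mono)
    fix i assume i: "i \<in> H"
    have "norm (sqrt (d i) *\<^sub>R perturbation t i) \<le> sqrt (d i) * (M * sqrt (N i) *
        (eta * (sqrt (d i) * (sqrt (2 / ?m) * S)) + sqrt (b i) / d i))"
      using norm_perturbation_le[OF i, of t] by (simp add: N_def b_def S_def mult_left_mono)
    also have "\<dots> = eta * S * (M * (sqrt (N i) * ((sqrt (d i) * sqrt (d i)) * sqrt (2 / ?m))))
        + M * (sqrt (N i) * (sqrt (d i) * (sqrt (b i) / d i)))"
      by (simp only: algebra_simps)
    also have "sqrt (d i) * (sqrt (b i) / d i) = sqrt (b i / d i)"
      using dm(5)[OF i] by (simp add: real_sqrt_divide field_simps)
    finally show "norm (sqrt (d i) *\<^sub>R perturbation t i) \<le> eta * S * f i + M * g i"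
      by (simp add: f_def g_def)
  qed simp
  also have "\<dots> \<le> L2_set (\<lambda>i. eta * S * f i) H + L2_set (\<lambda>i. M * g i) H"
    by (rule L2_set_triangle_ineq)
  also have "\<dots> = eta * S * L2_set f H + M * L2_set g H"
    using S0 M_nonneg parameters by (simp add: L2_set_right_distrib)
  also have "\<dots> \<le> eta * S * C1 G H B M + M * C2 G H B"
  proof (intro add_mono mult_left_mono)
    have "(\<Sum>i\<in>H. (f i)\<^sup>2) \<le> (\<Sum>i\<in>H. (2 * M)\<^sup>2 * (?n * ?D / ?m * N i))"
    proof (rule sum_mono)
      fix i assume i: "i \<in> H"
      have "d i * d i \<le> ?n * ?D" using dm[OF i] by (intro mult_mono) auto
      then have "2 * (d i * d i) \<le> 4 * (?n * ?D)" using dm[OF i] by (smt (verit) mult_nonneg_nonneg)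
      then have "M\<^sup>2 * N i / ?m * (2 * (d i * d i)) \<le> M\<^sup>2 * N i / ?m * (4 * (?n * ?D))"
        using m by (intro mult_left_mono) (auto simp: N_def)
      then show "(f i)\<^sup>2 \<le> (2 * M)\<^sup>2 * (?n * ?D / ?m * N i)"
        using m by (simp add: f_def power_mult_distrib N_def power2_eq_square[of "d i"] mult_ac)
    qed
    then have "L2_set f H \<le> sqrt ((2 * M)\<^sup>2 * (?n * ?D / ?m * (\<Sum>i\<in>H. N i)))"
      unfolding L2_set_def by (simp add: sum_distrib_left)
    also have "\<dots> = C1 G H B M"
      unfolding real_sqrt_mult[of "(2 * M)\<^sup>2"] real_sqrt_abs abs_mult abs_numeral abs_of_nonneg[OF M_nonneg]
      by (simp add: C1_def N_def)
    finally show "L2_set f H \<le> C1 G H B M" .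
  next
    have "(\<Sum>i\<in>H. (g i)\<^sup>2) \<le> (\<Sum>i\<in>H. 4 * (?n * ?D * ?mB) / ?m\<^sup>2 * N i)"
    proof (rule sum_mono)
      fix i assume i: "i \<in> H"
      have "card (nbrs G i \<inter> B) \<le> m_BH G H B"
        unfolding m_BH_eq using finite_H i by (intro member_le_sum) auto
      then have "b i \<le> ?mB" by (simp add: b_def)
      moreover have "1 / d i \<le> 4 * (?n * ?D) / ?m\<^sup>2"
      proof -
        have "?m * ?m \<le> ?D * d i" using dm[OF i] m by (intro mult_mono) auto
        also have "\<dots> \<le> (4 * ?n) * (?D * d i)"
          using dm[OF i] m mult_right_mono[of 1 "4 * ?n" "?D * d i"] by simp
        finally show ?thesis using dm[OF i] m by (simp add: field_simps power2_eq_square)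
      qed
      ultimately have "b i * (1 / d i) \<le> ?mB * (4 * (?n * ?D) / ?m\<^sup>2)"
        using dm[OF i] by (intro mult_mono) (auto simp: b_def)
      then have "N i * (b i * (1 / d i)) \<le> N i * (?mB * (4 * (?n * ?D) / ?m\<^sup>2))"
        by (rule mult_left_mono) (simp add: N_def)
      then show "(g i)\<^sup>2 \<le> 4 * (?n * ?D * ?mB) / ?m\<^sup>2 * N i"
        by (simp add: g_def power_mult_distrib N_def b_def mult_ac)
    qed
    then have "L2_set g H \<le> sqrt (4 * (?n * ?D * ?mB) / ?m\<^sup>2 * (\<Sum>i\<in>H. N i))"
      unfolding L2_set_def by (simp add: sum_distrib_left)
    also have "\<dots> = C2 G H B"
    proof -
      have "sqrt 4 = (2::real)" by (rule real_sqrt_unique) auto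
      then show ?thesis
        using m by (simp add: C2_def N_def real_sqrt_mult real_sqrt_divide)
    qed
    finally show "L2_set g H \<le> C2 G H B" .
  qed (use S0 parameters M_nonneg in auto)
  finally show ?thesis by (simp add: S_def mult_ac)
qed

text \<open>
  A step of the iteration is the lazy averaging step plus \<open>alpha\<close> times the perturbation. Averaging
  commutes with taking the disagreement and contracts it by \<open>rho0\<close>.
\<close>

lemma err_recursion:
  "err (Suc t) \<le> rho0 G H alpha * err t
    + alpha * eta * C1 G H B M * cum_loss lam err t + alpha * C2 G H B * M"
proof -
  let ?E = "disagreement G H (x t)"
  let ?W = "\<lambda>X i. (1 - alpha) *\<^sub>R X i + alpha *\<^sub>R average X i"
  have update: "x (Suc t) i = ?W (x t) i + alpha *\<^sub>R perturbation t i" if "i \<in> H" for i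
    by (simp add: state_update[OF that] perturbation_def algebra_simps)
  have centre_lin: "centre (\<lambda>i. a *\<^sub>R X i + b *\<^sub>R Y i) = a *\<^sub>R centre X + b *\<^sub>R centre Y" for a b X and Y :: "nat \<Rightarrow> real ^ 'd"
    by (simp add: centre_def scaleR_add_right sum.distrib scaleR_sum_right mult.commute)
  have "centre (x (Suc t)) = centre (\<lambda>i. 1 *\<^sub>R ?W (x t) i + alpha *\<^sub>R perturbation t i)"
    unfolding centre_def by (intro sum.cong) (simp_all add: update)
  also have "\<dots> = centre (x t) + alpha *\<^sub>R centre (perturbation t)"
    unfolding centre_lin centre_average by (simp add: algebra_simps)
  finally have centre_Suc: "centre (x (Suc t)) = centre (x t) + alpha *\<^sub>R centre (perturbation t)" .
  have "disagreement G H (x (Suc t)) i = ?W ?E i + alpha *\<^sub>R disagreement G H (perturbation t) i"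
    if "i \<in> H" for i
    using that by (simp add: disagreement_eq disagreement_average update centre_Suc algebra_simps)
  then have "err (Suc t) = norm_D G H (\<lambda>i. ?W ?E i + alpha *\<^sub>R disagreement G H (perturbation t) i)"
    unfolding err_def by (rule norm_D_cong)
  also have "\<dots> \<le> norm_D G H (?W ?E) + norm_D G H (\<lambda>i. alpha *\<^sub>R disagreement G H (perturbation t) i)"
    by (rule norm_D_triangle)
  also have "\<dots> \<le> rho0 G H alpha * err t + alpha * norm_D G H (perturbation t)"
  proof (rule add_mono)
    show "norm_D G H (?W ?E) \<le> rho0 G H alpha * err t"
      unfolding err_def using parameters rho0_nonneg disagreement_centred by (intro averaging_contracts) auto
    show "norm_D G H (\<lambda>i. alpha *\<^sub>R disagreement G H (perturbation t) i) \<le> alpha * norm_D G H (perturbation t)"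
      using parameters norm_D_disagreement_le by (simp add: norm_D_scale)
  qed
  also have "alpha * norm_D G H (perturbation t)
      \<le> alpha * (eta * C1 G H B M * cum_loss lam err t + C2 G H B * M)"
    using parameters norm_D_perturbation_le by (intro mult_left_mono) auto
  finally show ?thesis by (simp add: algebra_simps)
qed

end

section \<open>Convergence to a neighbourhood of consensus\<close>

theorem theorem1:
  fixes n :: nat
    and G :: "nat pair_pre_digraph"
    and H B :: "nat set"
    and alpha eta lam MB M :: real
    and x :: "nat \<Rightarrow> nat \<Rightarrow> real ^ 'd"
    and msg :: "nat \<Rightarrow> nat \<Rightarrow> nat \<Rightarrow> real ^ 'd"
  defines "M \<equiv> M_const H (x 0) MB"
  assumes graph: "pair_graph G" "pverts G = {1..n}" "Digraph_Component.connected (with_proj G)"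
    and nodes: "H \<union> B = {1..n}" "H \<inter> B = {}" "H \<noteq> {}"
    and run: "A_RepC G H alpha eta lam x msg"
    and A1: "\<forall>i\<in>H. card (nbrs G i \<inter> H) > card (nbrs G i \<inter> B)"
    and A2: "Digraph_Component.connected (induce_subgraph (with_proj G) H)"
    and A3: "MB > 0" "\<forall>t. \<forall>i\<in>H. \<forall>j\<in>nbrs G i \<inter> B. norm (msg t j i) \<le> MB"
    and lam: "0 \<le> lam" "lam < 1"
    and alpha: "0 < alpha" "alpha < 1"
    and eta: "eta > 0"
    and step: "alpha * eta * C1 G H B M < (1 - rho0 G H alpha) * (1 - lam)"
  shows "(\<exists>kappa rho. kappa \<ge> 1 \<and> 0 < rho \<and> rho < 1 \<and>
           (\<forall>t. norm_D G H (disagreement G H (x t))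
              \<le> kappa * rho ^ t * norm_D G H (disagreement G H (x 0))
                 + alpha * C2 G H B * M
                   / ((1 - rho0 G H alpha) * (1 - lam) - alpha * eta * C1 G H B M)))
       \<and> limsup (\<lambda>t. ereal (norm_D G H (disagreement G H (x t))))
           \<le> ereal (alpha * C2 G H B * M
                   / ((1 - rho0 G H alpha) * (1 - lam) - alpha * eta * C1 G H B M))"
proof -
  have "finite H" using nodes(1) by (metis finite_Un finite_atLeastAtMost)
  then have M_init: "norm (x 0 i) \<le> M" if "i \<in> H" for i
    using that unfolding M_def M_const_def by (intro max.coboundedI1 Max_ge) auto
  have M_byz: "norm (msg t j i) \<le> M" if "i \<in> H" "j \<in> nbrs G i \<inter> B" for t i j
    using that A3 unfolding M_def M_const_def by (intro max.coboundedI2) auto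
  have pos: "0 < hdeg G H i" if "i \<in> H" for i
    using A1 that unfolding hdeg_def by (metis less_nat_zero_code neq0_conv)
  have H_sub: "H \<subseteq> pverts G" using nodes graph by auto
  interpret byzantine_run G H B alpha eta lam M x msg
    by (intro byzantine_run.intro honest_network.intro byzantine_run_axioms.intro)
      (use graph nodes run A1 A2 H_sub pos M_init M_byz alpha eta lam in auto)
  let ?gap = "(1 - rho0 G H alpha) * (1 - lam) - alpha * eta * C1 G H B M"
  let ?F = "alpha * C2 G H B * M / ?gap"
  have C1: "0 \<le> C1 G H B M" and C2: "0 \<le> C2 G H B"
    using M_nonneg by (simp_all add: C1_def C2_def sum_nonneg)
  obtain rho where rho: "0 < rho" "rho < 1"
    and decay: "\<And>t. err t \<le> rho ^ t * err 0 + alpha * C2 G H B * M * (1 - lam) / ?gap"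
    by (rule geometric_decay_with_fading_memory[of err lam "rho0 G H alpha"
          "alpha * eta * C1 G H B M" "alpha * C2 G H B * M"])
      (use C1 C2 M_nonneg rho0_nonneg lam alpha eta step err_recursion
        in \<open>auto simp: err_def norm_D_nonneg\<close>)
  have gap: "0 < ?gap" using step by simp
  \<comment> \<open>The recursion yields the offset with an extra factor \<open>1 - lam\<close>, which is at most 1.\<close>
  have bound: "err t \<le> rho ^ t * err 0 + ?F" for t
  proof -
    have "alpha * C2 G H B * M * (1 - lam) \<le> alpha * C2 G H B * M * 1"
      using C2 M_nonneg alpha lam by (intro mult_left_mono) auto
    then have "alpha * C2 G H B * M * (1 - lam) / ?gap \<le> ?F"
      using gap by (intro divide_right_mono) auto
    with decay[of t] show ?thesis by linarith
  qed
  have "(\<lambda>t. rho ^ t * err 0 + ?F) \<longlonglongrightarrow> 0 * err 0 + ?F"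
    using rho by (intro tendsto_intros LIMSEQ_power_zero) simp
  then have "limsup (\<lambda>t. ereal (rho ^ t * err 0 + ?F)) = ereal ?F"
    by (intro lim_imp_Limsup) simp_all
  moreover have "limsup (\<lambda>t. ereal (err t)) \<le> limsup (\<lambda>t. ereal (rho ^ t * err 0 + ?F))"
    by (intro Limsup_mono always_eventually) (use bound in simp)
  ultimately have "limsup (\<lambda>t. ereal (err t)) \<le> ereal ?F"
    by simp
  moreover have "\<exists>kappa rho. kappa \<ge> 1 \<and> 0 < rho \<and> rho < 1 \<and> (\<forall>t. err t \<le> kappa * rho ^ t * err 0 + ?F)"
    using rho bound by (intro exI[of _ 1] exI[of _ rho]) simp
  ultimately show ?thesis unfolding err_def by blast
qed

end
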